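(* (i) Let $\sigma=0$ and $q<s+1$. Then there are positive constants $c,\gamma$ independent of $d_1,d_2$ such that every positive smooth solution $(u,v)$ of the stationary system satisfies $$u\le c\left(1+\left(\tfrac{d_2}{d_1}\right)^{\gamma}\right),\qquad v\le c\left(1+\left(\tfrac{d_2}{d_1}\right)^{\frac{r}{s+1}\gamma}\right).$$ (ii) Let $\sigma=0$ and $\left(\max\left\{1,\frac{d_2}{d_1}\right\}\right)r<s+1$. Then there is a positive constant $c$ depending only on $p,q,r,s$ and $\frac{d_2}{d_1}$ such that every positive smooth solution satisfies $$u\ge c,\qquad v\ge c^{\frac{r}{s+1}},$$ where $c\to0$ as $\frac{d_2}{d_1}\to\frac{s+1}{r}$. (iii) Let $\sigma>0$ and $p-1<r$. Then there are positive constants $c,\gamma$ independent of $d_1,d_2$ such that every positive smooth solution satisfies $$u\le c\left(1+\left(\tfrac{d_2}{d_1}\right)^{\gamma}\right),\qquad v\le c\left(1+\left(\tfrac{d_2}{d_1}\right)^{\frac{r}{s+1}\gamma}\right).$$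
   Context: $\Omega\subset\mathbb{R}^n$, $n\ge1$, is a bounded smooth domain with unit outer normal $\nu$ on $\partial\Omega$; $d_1,d_2>0$; $\sigma\ge0$ is a constant; $p,q,r,s\ge0$ satisfy $0<\frac{p-1}{r}<\frac{q}{s+1}$. The stationary system is $$d_1\Delta u-u+\frac{u^p}{v^q}+\sigma=0,\quad d_2\Delta v-v+\frac{u^r}{v^s}=0\ \text{ in }\Omega,\qquad \frac{\partial u}{\partial\nu}=\frac{\partial v}{\partial\nu}=0\ \text{ on }\partial\Omega.$$ A positive smooth solution is a pair $u,v\in C^\infty(\overline\Omega)$ with $u,v>0$ in $\overline\Omega$ solving it. *)

theory Defs
  imports "HOL-Analysis.Analysis"
begin

text \<open>
  The constant in the lower bound may not depend on the dimension, so the dimension has to be an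
  ordinary natural number. We therefore use the library topology \<^const>\<open>Euclidean_space\<close>
  \<open>n\<close>, whose points are the \<open>x :: nat \<Rightarrow> real\<close> with \<open>x i = 0\<close> for all \<open>i \<ge> n\<close>; the
  coordinates of a point are \<open>x 0, \<dots>, x (n - 1)\<close>.
\<close>

definition partial :: "nat \<Rightarrow> ((nat \<Rightarrow> real) \<Rightarrow> real) \<Rightarrow> (nat \<Rightarrow> real) \<Rightarrow> real" where
  "partial i f x = deriv (\<lambda>t. f (x(i := t))) (x i)"

definition iter_partial ::
    "nat list \<Rightarrow> ((nat \<Rightarrow> real) \<Rightarrow> real) \<Rightarrow> (nat \<Rightarrow> real) \<Rightarrow> real" where
  "iter_partial is f = foldr partial is f"

definition laplacian :: "nat \<Rightarrow> ((nat \<Rightarrow> real) \<Rightarrow> real) \<Rightarrow> (nat \<Rightarrow> real) \<Rightarrow> real" where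
  "laplacian n f x = (\<Sum>i<n. partial i (partial i f) x)"

text \<open>
  \<open>C\<^sup>\<infinity>(U)\<close> for \<open>U\<close> open in \<open>n\<close>-space: all iterated partial derivatives exist and are continuous
  on \<open>U\<close>. The separate differentiability clause is needed because \<^const>\<open>deriv\<close> is total.
\<close>
definition smooth_on_open :: "nat \<Rightarrow> (nat \<Rightarrow> real) set \<Rightarrow> ((nat \<Rightarrow> real) \<Rightarrow> real) \<Rightarrow> bool" where
  "smooth_on_open n U f \<longleftrightarrow>
     openin (Euclidean_space n) U \<and>
     (\<forall>is. set is \<subseteq> {..<n} \<longrightarrow>
        continuous_map (subtopology (Euclidean_space n) U) euclideanreal (iter_partial is f) \<and>
        (\<forall>x\<in>U. \<forall>i<n. (\<lambda>t. iter_partial is f (x(i := t))) differentiable (at (x i))))"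

text \<open>
  \<open>C\<^sup>\<infinity>\<close> up to the boundary: \<open>f\<close> is continuous on the closure, smooth inside, and every partial
  derivative extends continuously from \<open>\<Omega>\<close> to the closure.
\<close>
definition smooth_on_closure ::
    "nat \<Rightarrow> (nat \<Rightarrow> real) set \<Rightarrow> ((nat \<Rightarrow> real) \<Rightarrow> real) \<Rightarrow> bool" where
  "smooth_on_closure n \<Omega> f \<longleftrightarrow>
     smooth_on_open n \<Omega> f \<and>
     continuous_map (subtopology (Euclidean_space n) (Euclidean_space n closure_of \<Omega>))
       euclideanreal f \<and>
     (\<forall>is. set is \<subseteq> {..<n} \<longrightarrow>
        (\<exists>g. continuous_map (subtopology (Euclidean_space n) (Euclidean_space n closure_of \<Omega>))
               euclideanreal g \<and>
             (\<forall>x\<in>\<Omega>. g x = iter_partial is f x)))"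

text \<open>
  \<open>\<phi>\<close> is a smooth defining function for \<open>\<Omega>\<close> on the neighbourhood \<open>U\<close> of the boundary point
  \<open>x\<^sub>0\<close>, negative inside \<open>\<Omega>\<close>, so that its gradient points out of \<open>\<Omega>\<close>.
\<close>
definition local_defining_function ::
    "nat \<Rightarrow> (nat \<Rightarrow> real) set \<Rightarrow> (nat \<Rightarrow> real) \<Rightarrow> (nat \<Rightarrow> real) set \<Rightarrow>
     ((nat \<Rightarrow> real) \<Rightarrow> real) \<Rightarrow> bool" where
  "local_defining_function n \<Omega> x\<^sub>0 U \<phi> \<longleftrightarrow>
     openin (Euclidean_space n) U \<and> x\<^sub>0 \<in> U \<and> smooth_on_open n U \<phi> \<and>
     (\<forall>x\<in>U. \<exists>i<n. partial i \<phi> x \<noteq> 0) \<and>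
     \<Omega> \<inter> U = {x \<in> U. \<phi> x < 0} \<and>
     (Euclidean_space n frontier_of \<Omega>) \<inter> U = {x \<in> U. \<phi> x = 0}"

definition bounded_smooth_domain :: "nat \<Rightarrow> (nat \<Rightarrow> real) set \<Rightarrow> bool" where
  "bounded_smooth_domain n \<Omega> \<longleftrightarrow>
     \<Omega> \<noteq> {} \<and> openin (Euclidean_space n) \<Omega> \<and> connectedin (Euclidean_space n) \<Omega> \<and>
     (\<exists>B. \<forall>x\<in>\<Omega>. L2_set x {..<n} \<le> B) \<and>
     (\<forall>x\<^sub>0 \<in> Euclidean_space n frontier_of \<Omega>. \<exists>U \<phi>. local_defining_function n \<Omega> x\<^sub>0 U \<phi>)"

definition unit_outer_normal ::
    "nat \<Rightarrow> (nat \<Rightarrow> real) set \<Rightarrow> (nat \<Rightarrow> real) \<Rightarrow> (nat \<Rightarrow> real) \<Rightarrow> bool" where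
  "unit_outer_normal n \<Omega> x\<^sub>0 \<nu> \<longleftrightarrow>
     (\<exists>U \<phi>. local_defining_function n \<Omega> x\<^sub>0 U \<phi> \<and>
        \<nu> = (\<lambda>i. if i < n then partial i \<phi> x\<^sub>0 / L2_set (\<lambda>j. partial j \<phi> x\<^sub>0) {..<n} else 0))"

text \<open>
  The derivative along \<open>\<nu>\<close> is one-sided, since \<open>f\<close> is only meaningful on the closure of \<open>\<Omega>\<close>
  and \<open>x + t\<nu>\<close> lies in \<open>\<Omega>\<close> for small \<open>t < 0\<close>. The quantifier over \<open>\<nu>\<close> is harmless: for a
  smooth domain the outer normal exists and is unique, i.e. independent of \<open>\<phi>\<close>.
\<close>
definition neumann_zero ::
    "nat \<Rightarrow> (nat \<Rightarrow> real) set \<Rightarrow> ((nat \<Rightarrow> real) \<Rightarrow> real) \<Rightarrow> bool" where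
  "neumann_zero n \<Omega> f \<longleftrightarrow>
     (\<forall>x \<in> Euclidean_space n frontier_of \<Omega>. \<forall>\<nu>. unit_outer_normal n \<Omega> x \<nu> \<longrightarrow>
        ((\<lambda>t. f (\<lambda>i. x i + t * \<nu> i)) has_real_derivative 0) (at_left 0))"

definition positive_smooth_solution ::
    "nat \<Rightarrow> (nat \<Rightarrow> real) set \<Rightarrow> real \<Rightarrow> real \<Rightarrow> real \<Rightarrow> real \<Rightarrow> real \<Rightarrow> real \<Rightarrow> real \<Rightarrow>
     ((nat \<Rightarrow> real) \<Rightarrow> real) \<Rightarrow> ((nat \<Rightarrow> real) \<Rightarrow> real) \<Rightarrow> bool" where
  "positive_smooth_solution n \<Omega> d\<^sub>1 d\<^sub>2 \<sigma> p q r s u v \<longleftrightarrow>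
     smooth_on_closure n \<Omega> u \<and> smooth_on_closure n \<Omega> v \<and>
     (\<forall>x \<in> Euclidean_space n closure_of \<Omega>. u x > 0 \<and> v x > 0) \<and>
     (\<forall>x\<in>\<Omega>. d\<^sub>1 * laplacian n u x - u x + u x powr p / v x powr q + \<sigma> = 0 \<and>
            d\<^sub>2 * laplacian n v x - v x + u x powr r / v x powr s = 0) \<and>
     neumann_zero n \<Omega> u \<and> neumann_zero n \<Omega> v"

end

theory Submission
  imports Defs
begin

text \<open>
  All estimates come from evaluating the two equations at maximum points of functions
  \<open>\<alpha> ln u + \<beta> ln v\<close> on the closed domain. At such a point \<open>x\<close> the gradient vanishes and the Laplacian
  is nonpositive, also when \<open>x\<close> lies on the boundary, because of the Neumann condition
  (\<open>neumann_maximum\<close>). The Laplacian of \<open>\<alpha> ln u + \<beta> ln v\<close> is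
  \<open>\<alpha> \<Delta>u/u + \<beta> \<Delta>v/v\<close> minus \<open>\<alpha> |\<nabla>u|\<^sup>2/u\<^sup>2 + \<beta> |\<nabla>v|\<^sup>2/v\<^sup>2\<close>. Where the
  gradient vanishes, \<open>\<nabla>u/u\<close> and \<open>\<nabla>v/v\<close> are proportional, and the subtracted term has the sign
  of \<open>\<alpha> \<beta> (\<alpha> + \<beta>)\<close>. So if this number is \<open>\<le> 0\<close>, the differential equations turn into a purely
  algebraic inequality between \<open>u\<close> and \<open>v\<close> at \<open>x\<close> (\<open>log_combination_maximum\<close>).

  The choices \<open>(\<plusminus>1, 0)\<close> and \<open>(0, \<plusminus>1)\<close> compare \<open>u\<close> and \<open>v\<close> at their extrema. They give
  \<open>\<sigma> \<le> u\<close> and show that any bound for \<open>u\<close> carries over to \<open>v\<close> with exponent \<open>r/(s+1)\<close>.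

  For the upper bounds, maximise \<open>u\<^sup>k/v\<close> with \<open>k \<ge> 1\<close> large. Write \<open>M\<close> for the maximum of \<open>u\<close> and
  \<open>W\<close> for that of \<open>u\<^sup>k/v\<close>. At the maximum of \<open>u\<close> the first equation bounds \<open>v\<^sup>q\<close> by a multiple of
  \<open>M\<close> to the power \<open>p - 1\<close>, which makes \<open>W\<close>, up to a constant factor, at least a positive
  power of \<open>M\<close>. At the maximum of \<open>u\<^sup>k/v\<close> the algebraic inequality bounds \<open>W\<close> by a power of \<open>M\<close>, with a factor that is affine in
  \<open>d\<^sub>2/d\<^sub>1\<close>. Since \<open>(p - 1)/r < q/(s + 1)\<close>, these two facts bound \<open>M\<close> (\<open>activator_le\<close>), provided that
  \<open>q < s + 1\<close>. When \<open>\<sigma> > 0\<close>, the bound \<open>\<sigma> \<le> u\<close> keeps \<open>v\<close> away from zero, so that \<open>q\<close> can be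
  replaced by a smaller exponent \<open>Q < s + 1\<close>; the condition \<open>p - 1 < r\<close> is what makes room for \<open>Q\<close>.

  For the lower bounds, maximise \<open>v/u\<^sup>k\<close> with \<open>k = r/(s+1) < 1\<close>. The inequality at the maximum point
  bounds this quotient as soon as \<open>k d\<^sub>2/d\<^sub>1 < 1\<close>, and then the inequality at the minimum of \<open>u\<close> bounds
  \<open>u\<close> from below (\<open>activator_ge\<close>).
\<close>

section \<open>Topology and directional derivatives in coordinate space\<close>

text \<open>
  In the product topology a neighbourhood restricts only finitely many coordinates, hence it contains
  a box with the same radius in every coordinate.
\<close>
lemma open_contains_box:
  fixes S :: "(nat \<Rightarrow> real) set"
  assumes "open S" "x \<in> S"
  shows "\<exists>\<delta>>0. \<forall>y. (\<forall>i. \<bar>y i - x i\<bar> < \<delta>) \<longrightarrow> y \<in> S"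
proof -
  obtain X where X: "x \<in> (\<Pi>\<^sub>E i\<in>UNIV. X i)" "\<And>i. open (X i)" "finite {i. X i \<noteq> UNIV}"
      "(\<Pi>\<^sub>E i\<in>UNIV. X i) \<subseteq> S"
    using product_topology_open_contains_basis[of "\<lambda>_. euclidean" UNIV S x] assms
    by (auto simp: euclidean_product_topology)
  have "\<forall>\<^sub>F \<delta> in at_right 0. \<forall>i\<in>{i. X i \<noteq> UNIV}. ball (x i) \<delta> \<subseteq> X i"
  proof (rule eventually_ball_finite[OF X(3)], rule ballI)
    fix i
    have "x i \<in> X i" using X(1) by auto
    then obtain e where e: "e > 0" "ball (x i) e \<subseteq> X i"
      using X(2) open_contains_ball by blast
    show "\<forall>\<^sub>F \<delta> in at_right 0. ball (x i) \<delta> \<subseteq> X i"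
      unfolding eventually_at_right_field using e by (intro exI[of _ e]) force
  qed
  then obtain d where d: "d > 0" "\<And>\<delta>. 0 < \<delta> \<Longrightarrow> \<delta> < d \<Longrightarrow> \<forall>i\<in>{i. X i \<noteq> UNIV}. ball (x i) \<delta> \<subseteq> X i"
    unfolding eventually_at_right_field by auto
  have "y \<in> S" if "\<forall>i. \<bar>y i - x i\<bar> < d / 2" for y
  proof -
    have "y i \<in> X i" for i
    proof (cases "X i = UNIV")
      case False
      hence "ball (x i) (d / 2) \<subseteq> X i" using d by auto
      moreover have "y i \<in> ball (x i) (d / 2)"
        using that by (simp add: dist_real_def abs_minus_commute)
      ultimately show ?thesis by blast
    qed simp
    thus ?thesis using X(4) by auto
  qed
  thus ?thesis using d(1) by (intro exI[of _ "d/2"]) auto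
qed

lemma Euclidean_space_top_of_set:
  "Euclidean_space n = top_of_set (topspace (Euclidean_space n))"
  by (simp add: Euclidean_space_def euclidean_product_topology)

text \<open>
  Openness and continuity in terms of the coordinates, in the form in which the mean value estimate
  for directional derivatives uses them.
\<close>
lemma openin_contains_box:
  assumes U: "openin (Euclidean_space n) U" "x \<in> U"
    and f: "continuous_on U f" and e: "(e::real) > 0"
  shows "\<exists>\<delta>>0. \<forall>y\<in>topspace (Euclidean_space n). (\<forall>i<n. \<bar>y i - x i\<bar> < \<delta>) \<longrightarrow>
           y \<in> U \<and> \<bar>f y - f x\<bar> < e"
proof -
  obtain V where V: "open V" "U = topspace (Euclidean_space n) \<inter> V"
    using U(1) by (subst (asm) Euclidean_space_top_of_set) (auto simp: openin_open)
  obtain W where W: "open W" "W \<inter> U = f -` ball (f x) e \<inter> U"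
    using f unfolding continuous_on_open_invariant by (meson open_ball)
  have "x \<in> W \<inter> V" using U(2) V W e by auto
  then obtain d where d: "d > 0" "\<And>y. (\<forall>i. \<bar>y i - x i\<bar> < d) \<Longrightarrow> y \<in> W \<inter> V"
    using open_contains_box[of "W \<inter> V" x] V(1) W(1) by auto
  show ?thesis
  proof (intro exI[of _ d] conjI ballI impI)
    fix y assume y: "y \<in> topspace (Euclidean_space n)" "\<forall>i<n. \<bar>y i - x i\<bar> < d"
    have "\<bar>y i - x i\<bar> < d" for i
      using y U(2) V(2) d(1) by (cases "i < n") (auto simp: topspace_Euclidean_space)
    hence "y \<in> W \<inter> V" using d(2) by auto
    thus "y \<in> U" using V(2) y by auto
    with \<open>y \<in> W \<inter> V\<close> have "y \<in> W \<inter> U" by auto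
    thus "\<bar>f y - f x\<bar> < e" using W(2) by (auto simp: dist_real_def abs_minus_commute)
  qed (use d in auto)
qed

text \<open>
  Continuous partial derivatives give directional derivatives: switch on the coordinates of \<open>h\<close> one
  after the other. Each switch moves a single coordinate, so the mean value inequality controls it by
  a partial derivative at a point close to \<open>x\<close>.
\<close>
lemma has_directional_derivative_at_0:
  assumes U: "openin (Euclidean_space n) U" "x \<in> U"
    and h: "h \<in> topspace (Euclidean_space n)"
    and P: "\<And>i. i < n \<Longrightarrow> continuous_on U (P i)"
    and f: "\<And>y i. y \<in> U \<Longrightarrow> i < n \<Longrightarrow> ((\<lambda>t. f (y(i := t))) has_real_derivative P i y) (at (y i))"
  shows "((\<lambda>t. f (\<lambda>i. x i + t * h i)) has_real_derivative (\<Sum>i<n. h i * P i x)) (at 0)"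
proof -
  define c where "c = (\<lambda>k t i. x i + t * (if i < k then h i else 0))"
  have xE: "x \<in> topspace (Euclidean_space n)" using U openin_subset by blast
  have "((\<lambda>t. f (c k t)) has_real_derivative (\<Sum>i<k. h i * P i x)) (at 0)" if "k \<le> n" for k
    using that
  proof (induction k)
    case (Suc k)
    hence k: "k < n" by simp
    have "((\<lambda>t. f (c (Suc k) t) - f (c k t)) has_derivative (\<lambda>t. h k * P k x * t)) (at 0)"
      unfolding has_derivative_at_alt
    proof (intro conjI allI impI bounded_linear_mult_right)
      fix e :: real assume e: "e > 0"
      define H where "H = (\<Sum>i<n. \<bar>h i\<bar>) + 1"
      have hH: "\<bar>h i\<bar> < H" if "i < n" for i
        using member_le_sum[of i "{..<n}" "\<lambda>i. \<bar>h i\<bar>"] that by (auto simp: H_def)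
      have H: "H > 0" by (simp add: H_def sum_nonneg add_nonneg_pos)
      obtain d where d: "d > 0" "\<And>y. y \<in> topspace (Euclidean_space n) \<Longrightarrow>
          (\<forall>i<n. \<bar>y i - x i\<bar> < d) \<Longrightarrow> y \<in> U \<and> \<bar>P k y - P k x\<bar> < e / H"
        using openin_contains_box[OF U P[OF k], of "e / H"] e H by auto
      show "\<exists>d>0. \<forall>t. norm (t - 0) < d \<longrightarrow>
          norm (f (c (Suc k) t) - f (c k t) - (f (c (Suc k) 0) - f (c k 0)) - h k * P k x * (t - 0))
            \<le> e * norm (t - 0)"
      proof (intro exI[of _ "d / H"] conjI allI impI)
        fix t :: real assume t: "norm (t - 0) < d / H"
        have th: "\<bar>t * h i\<bar> < d" if "i < n" for i
        proof -
          have "\<bar>t * h i\<bar> \<le> \<bar>t\<bar> * H" using hH[OF that] by (simp add: abs_mult mult_left_mono)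
          also have "\<dots> < d" using t H by (simp add: field_simps)
          finally show ?thesis .
        qed
        define y where "y = (\<lambda>\<tau>. (c k t)(k := \<tau>))"
        let ?S = "{x k - d<..<x k + d}"
        have yU: "y \<tau> \<in> U \<and> \<bar>P k (y \<tau>) - P k x\<bar> < e / H" if "\<tau> \<in> ?S" for \<tau>
        proof (rule d(2))
          show "y \<tau> \<in> topspace (Euclidean_space n)"
            using xE k by (auto simp: y_def c_def topspace_Euclidean_space)
          show "\<forall>i<n. \<bar>y \<tau> i - x i\<bar> < d"
            using th that d(1) by (auto simp: y_def c_def)
        qed
        have der: "((\<lambda>\<tau>. f (y \<tau>) - P k x * \<tau>) has_real_derivative P k (y \<tau>) - P k x) (at \<tau> within ?S)"
          if "\<tau> \<in> ?S" for \<tau>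
        proof -
          have "((\<lambda>t. f ((y \<tau>)(k := t))) has_real_derivative P k (y \<tau>)) (at (y \<tau> k))"
            using yU[OF that] k by (intro f) auto
          hence "((\<lambda>t. f (y t)) has_real_derivative P k (y \<tau>)) (at \<tau>)"
            by (simp add: y_def)
          hence "((\<lambda>t. f (y t)) has_real_derivative P k (y \<tau>)) (at \<tau> within ?S)"
            by (rule has_field_derivative_at_within)
          thus ?thesis by (auto intro!: derivative_eq_intros)
        qed
        have "norm ((f (y (x k + t * h k)) - P k x * (x k + t * h k)) - (f (y (x k)) - P k x * x k))
            \<le> e / H * norm ((x k + t * h k) - x k)"
          using th[OF k] d(1) yU
          by (intro field_differentiable_bound[OF _ der]) (auto simp: less_imp_le abs_less_iff)
        also have "y (x k + t * h k) = c (Suc k) t"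
          by (auto simp: y_def c_def less_Suc_eq)
        also have "y (x k) = c k t" by (auto simp: y_def c_def)
        also have "e / H * norm ((x k + t * h k) - x k) \<le> e * \<bar>t\<bar>"
        proof -
          have "\<bar>t * h k\<bar> \<le> \<bar>t\<bar> * H" using hH[OF k] by (simp add: abs_mult mult_left_mono)
          hence "e / H * \<bar>t * h k\<bar> \<le> e / H * (\<bar>t\<bar> * H)" using e H by (intro mult_left_mono) auto
          thus ?thesis using H by simp
        qed
        finally show "norm (f (c (Suc k) t) - f (c k t) - (f (c (Suc k) 0) - f (c k 0)) - h k * P k x * (t - 0))
            \<le> e * norm (t - 0)"
          by (simp add: c_def algebra_simps)
      qed (use d H in auto)
    qed
    hence "((\<lambda>t. f (c (Suc k) t) - f (c k t)) has_real_derivative h k * P k x) (at 0)"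
      by (simp add: has_field_derivative_def)
    from DERIV_add[OF Suc.IH this] Suc.prems show ?case by simp
  qed (simp add: c_def)
  from this[of n] have "((\<lambda>t. f (c n t)) has_real_derivative (\<Sum>i<n. h i * P i x)) (at 0)" by simp
  moreover have "c n t = (\<lambda>i. x i + t * h i)" for t
    using h by (auto simp: c_def topspace_Euclidean_space)
  ultimately show ?thesis by simp
qed

lemma has_directional_derivative:
  assumes U: "openin (Euclidean_space n) U" "(\<lambda>i. x i + t * h i) \<in> U"
    and h: "h \<in> topspace (Euclidean_space n)"
    and P: "\<And>i. i < n \<Longrightarrow> continuous_on U (P i)"
    and f: "\<And>y i. y \<in> U \<Longrightarrow> i < n \<Longrightarrow> ((\<lambda>t. f (y(i := t))) has_real_derivative P i y) (at (y i))"
  shows "((\<lambda>t. f (\<lambda>i. x i + t * h i)) has_real_derivative (\<Sum>i<n. h i * P i (\<lambda>i. x i + t * h i))) (at t)"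
proof -
  have "((\<lambda>s. f (\<lambda>i. (x i + t * h i) + s * h i)) has_real_derivative
      (\<Sum>i<n. h i * P i (\<lambda>i. x i + t * h i))) (at 0)"
    by (rule has_directional_derivative_at_0[OF U h P f])
  moreover have "(\<lambda>i. (x i + t * h i) + s * h i) = (\<lambda>i. x i + (s + t) * h i)" for s
    by (auto simp: algebra_simps)
  ultimately show ?thesis using DERIV_shift[of "\<lambda>t. f (\<lambda>i. x i + t * h i)" _ 0 t] by simp
qed

lemma closure_of_Euclidean_space:
  assumes "\<Omega> \<subseteq> topspace (Euclidean_space n)"
  shows "Euclidean_space n closure_of \<Omega> = closure \<Omega>"
proof -
  have "closed (topspace (Euclidean_space n))"
    using closedin_Euclidean_space by (simp add: euclidean_product_topology)
  hence "closure \<Omega> \<subseteq> topspace (Euclidean_space n)" using assms by (simp add: closure_minimal)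
  thus ?thesis using assms
    by (subst Euclidean_space_top_of_set) (auto simp: closure_of_subtopology Int_absorb1 Int_absorb2)
qed

lemma continuous_map_Euclidean_subtopology:
  assumes "S \<subseteq> topspace (Euclidean_space n)"
  shows "continuous_map (subtopology (Euclidean_space n) S) euclideanreal f \<longleftrightarrow> continuous_on S f"
  using assms
  by (subst Euclidean_space_top_of_set) (simp add: subtopology_subtopology Int_absorb1)

lemma compact_closure_of_bounded_smooth_domain:
  assumes "bounded_smooth_domain n \<Omega>"
  shows "compact (Euclidean_space n closure_of \<Omega>)"
proof -
  obtain B where B: "\<And>x. x \<in> \<Omega> \<Longrightarrow> L2_set x {..<n} \<le> B"
    using assms by (auto simp: bounded_smooth_domain_def)
  have sub: "\<Omega> \<subseteq> topspace (Euclidean_space n)"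
    using assms openin_subset by (auto simp: bounded_smooth_domain_def)
  define box where "box = Pi\<^sub>E (UNIV :: nat set) (\<lambda>_. {-\<bar>B\<bar>..\<bar>B\<bar>})"
  have box: "compact box"
    using compactin_PiE[of "\<lambda>_. euclideanreal" UNIV "\<lambda>_. {-\<bar>B\<bar>..\<bar>B\<bar>}"]
    by (simp add: box_def euclidean_product_topology)
  have "\<Omega> \<subseteq> box"
  proof
    fix x assume x: "x \<in> \<Omega>"
    have "\<bar>x i\<bar> \<le> \<bar>B\<bar>" for i
    proof (cases "i < n")
      case True
      have "\<bar>x i\<bar> \<le> L2_set x {..<n}"
      proof -
        have "\<bar>x i\<bar> \<le> L2_set (\<lambda>i. \<bar>x i\<bar>) {..<n}" using True by (intro member_le_L2_set) auto
        thus ?thesis by (simp add: L2_set_def)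
      qed
      thus ?thesis using B[OF x] by linarith
    qed (use sub x in \<open>auto simp: topspace_Euclidean_space\<close>)
    thus "x \<in> box" by (auto simp: box_def abs_le_iff) (smt (verit) abs_le_iff)+
  qed
  hence "closure \<Omega> \<subseteq> box" using box by (intro closure_minimal compact_imp_closed)
  hence "compact (closure \<Omega>)" using box by (metis closed_closure compact_Int_closed inf.absorb2)
  thus ?thesis by (simp add: closure_of_Euclidean_space[OF sub])
qed

section \<open>Two-jets up to the boundary\<close>

text \<open>
  The partial derivatives of \<open>f\<close> are meaningful only inside \<open>\<Omega>\<close>. Carrying their continuous
  extensions \<open>G\<close> and \<open>H\<close> along as data makes the gradient and the Hessian available at boundary
  points, and the jet of a logarithmic combination of \<open>u\<close> and \<open>v\<close> is given by explicit formulas.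
\<close>
definition C2_jet :: "nat \<Rightarrow> (nat \<Rightarrow> real) set \<Rightarrow> ((nat \<Rightarrow> real) \<Rightarrow> real) \<Rightarrow>
    (nat \<Rightarrow> (nat \<Rightarrow> real) \<Rightarrow> real) \<Rightarrow> (nat \<Rightarrow> nat \<Rightarrow> (nat \<Rightarrow> real) \<Rightarrow> real) \<Rightarrow> bool" where
  "C2_jet n \<Omega> f G H \<longleftrightarrow>
     continuous_on (Euclidean_space n closure_of \<Omega>) f \<and>
     (\<forall>i<n. continuous_on (Euclidean_space n closure_of \<Omega>) (G i)) \<and>
     (\<forall>i<n. \<forall>j<n. continuous_on (Euclidean_space n closure_of \<Omega>) (H i j)) \<and>
     (\<forall>x\<in>\<Omega>. \<forall>i<n. ((\<lambda>t. f (x(i := t))) has_real_derivative G i x) (at (x i))) \<and>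
     (\<forall>x\<in>\<Omega>. \<forall>i<n. \<forall>j<n. ((\<lambda>t. G i (x(j := t))) has_real_derivative H i j x) (at (x j)))"

lemma smooth_on_closure_C2_jet:
  assumes "smooth_on_closure n \<Omega> f"
  obtains G H where "C2_jet n \<Omega> f G H" "\<And>x. x \<in> \<Omega> \<Longrightarrow> laplacian n f x = (\<Sum>i<n. H i i x)"
proof -
  have opn: "openin (Euclidean_space n) \<Omega>"
    and diff: "\<And>is x i. set is \<subseteq> {..<n} \<Longrightarrow> x \<in> \<Omega> \<Longrightarrow> i < n \<Longrightarrow>
        (\<lambda>t. iter_partial is f (x(i := t))) differentiable (at (x i))"
    using assms by (auto simp: smooth_on_closure_def smooth_on_open_def)
  have sub: "Euclidean_space n closure_of \<Omega> \<subseteq> topspace (Euclidean_space n)"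
    by (rule closure_of_subset_topspace)
  have "\<forall>is. \<exists>g. set is \<subseteq> {..<n} \<longrightarrow> continuous_on (Euclidean_space n closure_of \<Omega>) g \<and>
      (\<forall>x\<in>\<Omega>. g x = iter_partial is f x)"
    using assms unfolding smooth_on_closure_def continuous_map_Euclidean_subtopology[OF sub] by blast
  then obtain g where g: "\<And>is. set is \<subseteq> {..<n} \<Longrightarrow> continuous_on (Euclidean_space n closure_of \<Omega>) (g is)"
      "\<And>is x. set is \<subseteq> {..<n} \<Longrightarrow> x \<in> \<Omega> \<Longrightarrow> g is x = iter_partial is f x"
    by metis
  have der: "((\<lambda>t. iter_partial is f (x(i := t))) has_real_derivative iter_partial (i # is) f x) (at (x i))"
    if "set is \<subseteq> {..<n}" "x \<in> \<Omega>" "i < n" for "is" x i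
    using diff[OF that] by (simp add: iter_partial_def partial_def DERIV_deriv_iff_real_differentiable)
  have near: "\<forall>\<^sub>F t in nhds (x i). x(i := t) \<in> \<Omega>" if x: "x \<in> \<Omega>" and "i < n" for x i
  proof -
    obtain d where d: "d > 0" "\<And>y. y \<in> topspace (Euclidean_space n) \<Longrightarrow>
        (\<forall>i<n. \<bar>y i - x i\<bar> < d) \<Longrightarrow> y \<in> \<Omega>"
      using openin_contains_box[OF opn x continuous_on_const, of 1 0] by auto
    have "x \<in> topspace (Euclidean_space n)" using opn x openin_subset by blast
    hence "x(i := t) \<in> \<Omega>" if "dist t (x i) < d" for t
      using that \<open>i < n\<close> d(1) by (intro d(2)) (auto simp: topspace_Euclidean_space dist_real_def)
    thus ?thesis using d(1) unfolding eventually_nhds_metric by blast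
  qed
  show ?thesis
  proof (rule that[of "\<lambda>i. g [i]" "\<lambda>i j. g [j, i]"])
    have "continuous_on (Euclidean_space n closure_of \<Omega>) f"
      using assms by (auto simp: smooth_on_closure_def continuous_map_Euclidean_subtopology[OF sub])
    moreover have "((\<lambda>t. f (x(i := t))) has_real_derivative g [i] x) (at (x i))"
      if "x \<in> \<Omega>" "i < n" for x i
      using der[of "[]" x i] that g(2)[of "[i]" x] by (simp add: iter_partial_def)
    moreover have "((\<lambda>t. g [i] (x(j := t))) has_real_derivative g [j, i] x) (at (x j))"
      if "x \<in> \<Omega>" "i < n" "j < n" for x i j
    proof -
      have "\<forall>\<^sub>F t in nhds (x j). g [i] (x(j := t)) = iter_partial [i] f (x(j := t))"
        using near[OF \<open>x \<in> \<Omega>\<close> \<open>j < n\<close>] by eventually_elim (use that in \<open>auto intro: g(2)\<close>)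
      from DERIV_cong_ev[OF refl this refl] show ?thesis
        using der[of "[i]" x j] that g(2)[of "[j, i]" x] by simp
    qed
    ultimately show "C2_jet n \<Omega> f (\<lambda>i. g [i]) (\<lambda>i j. g [j, i])"
      by (auto simp: C2_jet_def intro!: g(1))
    show "laplacian n f x = (\<Sum>i<n. g [i, i] x)" if "x \<in> \<Omega>" for x
      using that by (auto simp: laplacian_def g(2) iter_partial_def intro!: sum.cong)
  qed
qed

section \<open>The maximum principle under a Neumann condition\<close>

text \<open>The rule of l'Hospital, applied to \<open>g t - g 0\<close> and \<open>t\<close>.\<close>
lemma right_derivative_limits:
  fixes g :: "real \<Rightarrow> real"
  assumes g: "(g \<longlongrightarrow> g 0) (at_right 0)"
    and g': "\<forall>\<^sub>F t in at_right 0. (g has_real_derivative g' t) (at t)"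
    and a: "(g' \<longlongrightarrow> a) (at_right 0)"
  shows "((\<lambda>t. (g t - g 0) / t) \<longlongrightarrow> a) (at_right 0)"
proof (rule lhopital_right_0[where f' = g' and g' = "\<lambda>_. 1"])
  show "((\<lambda>t. g t - g 0) \<longlongrightarrow> 0) (at_right 0)" using tendsto_diff[OF g tendsto_const[of "g 0"]] by simp
  show "\<forall>\<^sub>F t in at_right 0. ((\<lambda>t. g t - g 0) has_real_derivative g' t) (at t)"
    using g' by eventually_elim (auto intro!: derivative_eq_intros)
  show "\<forall>\<^sub>F t::real in at_right 0. t \<noteq> 0" by (auto simp: eventually_at_filter)
qed (use a in auto)

text \<open>
  Two applications of the rule of l'Hospital show that \<open>(g t - g 0) / t\<^sup>2\<close> tends to \<open>b / 2\<close> when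
  \<open>a = 0\<close>; at a maximum this quotient is nonpositive.
\<close>
lemma maximum_at_left_endpoint:
  fixes g :: "real \<Rightarrow> real"
  assumes g: "(g \<longlongrightarrow> g 0) (at_right 0)"
    and g': "\<forall>\<^sub>F t in at_right 0. (g has_real_derivative g' t) (at t)"
    and g'': "\<forall>\<^sub>F t in at_right 0. (g' has_real_derivative g'' t) (at t)"
    and a: "(g' \<longlongrightarrow> a) (at_right 0)" and b: "(g'' \<longlongrightarrow> b) (at_right 0)"
    and max: "\<forall>\<^sub>F t in at_right 0. g t \<le> g 0"
  shows "a \<le> 0" "a = 0 \<Longrightarrow> b \<le> 0"
proof -
  have pos: "\<forall>\<^sub>F t::real in at_right 0. t > 0" by (auto simp: eventually_at_filter)
  show "a \<le> 0"
  proof (rule tendsto_upperbound[OF right_derivative_limits[OF g g' a]])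
    show "\<forall>\<^sub>F t in at_right 0. (g t - g 0) / t \<le> 0"
      using max pos by eventually_elim (auto simp: divide_simps)
  qed simp
  show "b \<le> 0" if "a = 0"
  proof -
    have "((\<lambda>t. (g t - g 0) / t\<^sup>2) \<longlongrightarrow> b / 2) (at_right 0)"
    proof (rule lhopital_right_0[where f' = g' and g' = "\<lambda>t. 2 * t"])
      show "((\<lambda>t. g t - g 0) \<longlongrightarrow> 0) (at_right 0)" using tendsto_diff[OF g tendsto_const[of "g 0"]] by simp
      show "\<forall>\<^sub>F t in at_right 0. ((\<lambda>t. g t - g 0) has_real_derivative g' t) (at t)"
        using g' by eventually_elim (auto intro!: derivative_eq_intros)
      show "\<forall>\<^sub>F t::real in at_right 0. t\<^sup>2 \<noteq> 0" "\<forall>\<^sub>F t::real in at_right 0. 2 * t \<noteq> 0"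
        using pos by (eventually_elim; simp)+
      show "\<forall>\<^sub>F t::real in at_right 0. ((\<lambda>t. t\<^sup>2) has_real_derivative 2 * t) (at t)"
        by (auto intro!: always_eventually derivative_eq_intros)
      show "((\<lambda>t::real. t\<^sup>2) \<longlongrightarrow> 0) (at_right 0)" by (auto intro!: tendsto_eq_intros)
      show "((\<lambda>t. g' t / (2 * t)) \<longlongrightarrow> b / 2) (at_right 0)"
      proof (rule lhopital_right_0[where f' = g'' and g' = "\<lambda>t. 2"])
        show "(g' \<longlongrightarrow> 0) (at_right 0)" using a that by simp
        show "((\<lambda>t::real. 2 * t) \<longlongrightarrow> 0) (at_right 0)" by (auto intro!: tendsto_eq_intros)
        show "\<forall>\<^sub>F t::real in at_right 0. 2 * t \<noteq> 0" using pos by eventually_elim simp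
        show "\<forall>\<^sub>F t::real in at_right 0. ((\<lambda>t. 2 * t) has_real_derivative 2) (at t)"
          by (auto intro!: always_eventually derivative_eq_intros)
      qed (use g'' b in \<open>auto intro!: tendsto_intros\<close>)
    qed
    moreover have "\<forall>\<^sub>F t in at_right 0. (g t - g 0) / t\<^sup>2 \<le> 0"
      using max by eventually_elim (auto simp: divide_simps)
    ultimately have "b / 2 \<le> 0" by (rule tendsto_upperbound) simp
    thus ?thesis by simp
  qed
qed

lemma ray_tendsto_start:
  fixes x h :: "nat \<Rightarrow> real"
  shows "((\<lambda>t i. x i + t * h i) \<longlongrightarrow> x) (at_right 0)"
proof -
  have "isCont (\<lambda>t i. x i + t * h i) 0"
    by (intro continuous_on_interior[of UNIV] continuous_on_coordinatewise_then_product continuous_intros) auto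
  thus ?thesis
    using filterlim_at_split[of "\<lambda>t i. x i + t * h i" "nhds x" 0] by (simp add: isCont_def)
qed

text \<open>
  Restricting \<open>f\<close> to a ray that enters \<open>\<Omega>\<close> reduces the first and second order conditions at a
  maximum to functions of one variable. The base point may lie on the boundary.
\<close>
lemma maximum_along_entering_ray:
  assumes opn: "openin (Euclidean_space n) \<Omega>" and jet: "C2_jet n \<Omega> f G H"
    and x: "x \<in> Euclidean_space n closure_of \<Omega>"
    and max: "\<forall>y\<in>Euclidean_space n closure_of \<Omega>. f y \<le> f x"
    and h: "h \<in> topspace (Euclidean_space n)"
    and enter: "\<forall>\<^sub>F t in at_right 0. (\<lambda>i. x i + t * h i) \<in> \<Omega>"
  shows "((\<lambda>t. (f (\<lambda>i. x i + t * h i) - f x) / t) \<longlongrightarrow> (\<Sum>i<n. h i * G i x)) (at_right 0)"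
    and "(\<Sum>i<n. h i * G i x) \<le> 0"
    and "(\<Sum>i<n. h i * G i x) = 0 \<Longrightarrow> (\<Sum>i<n. h i * (\<Sum>j<n. h j * H i j x)) \<le> 0"
proof -
  let ?p = "\<lambda>t i. x i + t * h i"
  let ?cl = "Euclidean_space n closure_of \<Omega>"
  have sub: "\<Omega> \<subseteq> ?cl" using opn by (simp add: closure_of_subset openin_subset)
  note p = ray_tendsto_start[of x h]
  have lim: "((\<lambda>t. F (?p t)) \<longlongrightarrow> F x) (at_right 0)" if "continuous_on ?cl F" for F :: "(nat \<Rightarrow> real) \<Rightarrow> real"
    using enter sub by (intro continuous_on_tendsto_compose[OF that p x]) (auto elim!: eventually_mono)
  have D1: "\<forall>\<^sub>F t in at_right 0. ((\<lambda>t. f (?p t)) has_real_derivative (\<Sum>i<n. h i * G i (?p t))) (at t)"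
    using enter
  proof eventually_elim
    case (elim t)
    show ?case
      using jet sub continuous_on_subset unfolding C2_jet_def
      by (intro has_directional_derivative[OF opn elim h]) blast+
  qed
  have D2: "\<forall>\<^sub>F t in at_right 0. ((\<lambda>t. \<Sum>i<n. h i * G i (?p t)) has_real_derivative
      (\<Sum>i<n. h i * (\<Sum>j<n. h j * H i j (?p t)))) (at t)"
    using enter
  proof eventually_elim
    case (elim t)
    have "((\<lambda>t. G i (?p t)) has_real_derivative (\<Sum>j<n. h j * H i j (?p t))) (at t)" if "i < n" for i
      using jet sub continuous_on_subset that unfolding C2_jet_def
      by (intro has_directional_derivative[OF opn elim h]) blast+
    thus ?case by (auto intro!: DERIV_sum DERIV_cmult)
  qed
  have lim0: "((\<lambda>t. f (?p t)) \<longlongrightarrow> f (?p 0)) (at_right 0)" using lim[of f] jet by (simp add: C2_jet_def)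
  have lim1: "((\<lambda>t. \<Sum>i<n. h i * G i (?p t)) \<longlongrightarrow> (\<Sum>i<n. h i * G i x)) (at_right 0)"
    using jet by (intro tendsto_intros lim) (auto simp: C2_jet_def)
  have lim2: "((\<lambda>t. \<Sum>i<n. h i * (\<Sum>j<n. h j * H i j (?p t))) \<longlongrightarrow>
      (\<Sum>i<n. h i * (\<Sum>j<n. h j * H i j x))) (at_right 0)"
    using jet by (intro tendsto_intros lim) (auto simp: C2_jet_def)
  have max': "\<forall>\<^sub>F t in at_right 0. f (?p t) \<le> f (?p 0)"
    using enter by eventually_elim (use max sub in auto)
  show "((\<lambda>t. (f (?p t) - f x) / t) \<longlongrightarrow> (\<Sum>i<n. h i * G i x)) (at_right 0)"
    using right_derivative_limits[OF lim0 D1 lim1] by simp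
  show "(\<Sum>i<n. h i * G i x) \<le> 0"
    by (rule maximum_at_left_endpoint(1)[OF lim0 D1 D2 lim1 lim2 max'])
  show "(\<Sum>i<n. h i * (\<Sum>j<n. h j * H i j x)) \<le> 0" if "(\<Sum>i<n. h i * G i x) = 0"
    by (rule maximum_at_left_endpoint(2)[OF lim0 D1 D2 lim1 lim2 max' that])
qed

text \<open>
  If an open half space of directions enters \<open>\<Omega>\<close> and \<open>G \<bullet> N = 0\<close>, then adding multiples of \<open>N\<close>
  moves any direction into the half space without changing its product with the gradient, so the
  gradient is zero. Then the Hessian form is nonpositive on the open half space, by continuity on its
  closure, and, being even, everywhere.
\<close>
lemma maximum_with_entering_half_space:
  assumes opn: "openin (Euclidean_space n) \<Omega>" and jet: "C2_jet n \<Omega> f G H"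
    and x: "x \<in> Euclidean_space n closure_of \<Omega>"
    and max: "\<forall>y\<in>Euclidean_space n closure_of \<Omega>. f y \<le> f x"
    and N: "N \<in> topspace (Euclidean_space n)" "N \<noteq> (\<lambda>_. 0)"
    and enter: "\<forall>h\<in>topspace (Euclidean_space n). (\<Sum>i<n. h i * N i) < 0 \<longrightarrow>
        (\<forall>\<^sub>F t in at_right 0. (\<lambda>i. x i + t * h i) \<in> \<Omega>)"
    and normal: "(\<Sum>i<n. N i * G i x) = 0"
    and k: "k < n"
  shows "G k x = 0" and "H k k x \<le> 0"
proof -
  note ray = maximum_along_entering_ray[OF opn jet x max]
  note enter = enter[rule_format]
  define S where "S = (\<Sum>i<n. N i * N i)"
  have S: "S > 0"
  proof -
    obtain i where i: "N i \<noteq> 0" using N(2) by auto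
    hence "i < n" using N(1) not_less by (auto simp: topspace_Euclidean_space)
    moreover have "N i * N i > 0" using i by (auto simp: zero_less_mult_iff linorder_neq_iff)
    ultimately show ?thesis unfolding S_def by (intro sum_pos2[of _ i]) auto
  qed
  \<comment> \<open>\<open>e c\<close> is \<open>c\<close> times the \<open>k\<close>-th basis vector.\<close>
  define e where "e = (\<lambda>c i. if i = k then c else (0::real))"
  have e_sum: "(\<Sum>i<n. e c i * F i) = c * F k" for c F
    using k by (simp add: e_def if_distrib [of "\<lambda>c. c * _"] cong: if_cong)
  have shift: "(\<lambda>i. e c i - \<delta> * N i) \<in> topspace (Euclidean_space n)" for c \<delta>
    using N(1) k by (auto simp: e_def topspace_Euclidean_space)
  have dot: "(\<Sum>i<n. (e c i - \<delta> * N i) * F i) = c * F k - \<delta> * (\<Sum>i<n. N i * F i)" for c \<delta> F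
    by (simp add: left_diff_distrib sum_subtractf e_sum sum_distrib_left mult.assoc)
  have "c * G k x \<le> 0" for c
  proof -
    have "(\<Sum>i<n. (e c i - (c * N k / S + 1) * N i) * N i) < 0"
    proof -
      have "(\<Sum>i<n. (e c i - (c * N k / S + 1) * N i) * N i) = c * N k - (c * N k / S + 1) * S"
        unfolding dot S_def ..
      also have "\<dots> = - S" using S by (simp add: distrib_right)
      finally show ?thesis using S by simp
    qed
    from ray(2)[OF shift enter[OF shift this]] show ?thesis by (simp add: dot normal)
  qed
  from this[of 1] this[of "-1"] show G0: "G k x = 0" by simp
  \<comment> \<open>The sign \<open>c\<close> turns the basis vector towards \<open>\<Omega>\<close>; a small multiple of \<open>N\<close> makes the
    direction strictly entering.\<close>
  obtain c where c: "c * N k \<le> 0" "c * c = (1::real)"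
    by (cases "N k \<le> 0") (auto intro: that[of 1] that[of "-1"])
  have "\<forall>\<^sub>F \<delta> in at_right 0.
      (\<Sum>i<n. (e c i - \<delta> * N i) * (\<Sum>j<n. (e c j - \<delta> * N j) * H i j x)) \<le> 0"
  proof -
    have "\<forall>\<^sub>F \<delta>::real in at_right 0. \<delta> > 0" by (auto simp: eventually_at_filter)
    thus ?thesis
    proof eventually_elim
      case (elim \<delta>)
      have "\<delta> * S > 0" using elim S by simp
      hence "(\<Sum>i<n. (e c i - \<delta> * N i) * N i) < 0"
        using c(1) unfolding dot S_def by linarith
      from ray(3)[OF shift enter[OF shift this]] show ?case by (simp add: dot normal G0)
    qed
  qed
  moreover have "((\<lambda>\<delta>. \<Sum>i<n. (e c i - \<delta> * N i) * (\<Sum>j<n. (e c j - \<delta> * N j) * H i j x)) \<longlongrightarrow>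
      (\<Sum>i<n. (e c i - 0 * N i) * (\<Sum>j<n. (e c j - 0 * N j) * H i j x))) (at_right 0)"
    by (intro tendsto_intros)
  ultimately have "(\<Sum>i<n. (e c i - 0 * N i) * (\<Sum>j<n. (e c j - 0 * N j) * H i j x)) \<le> 0"
    by (intro tendsto_upperbound[where F = "at_right 0"]) auto
  also have "(\<Sum>i<n. (e c i - 0 * N i) * (\<Sum>j<n. (e c j - 0 * N j) * H i j x)) = c * c * H k k x"
    by (simp add: e_sum)
  finally show "H k k x \<le> 0" using c(2) by simp
qed

lemma interior_ray:
  assumes opn: "openin (Euclidean_space n) \<Omega>" "x \<in> \<Omega>" and h: "h \<in> topspace (Euclidean_space n)"
  shows "\<forall>\<^sub>F t in at_right 0. (\<lambda>i. x i + t * h i) \<in> \<Omega>"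
proof -
  obtain V where V: "open V" "\<Omega> = topspace (Euclidean_space n) \<inter> V"
    using opn(1) by (subst (asm) Euclidean_space_top_of_set) (auto simp: openin_open)
  have "\<forall>\<^sub>F t in at_right 0. (\<lambda>i. x i + t * h i) \<in> V"
    using topological_tendstoD[OF ray_tendsto_start V(1)] V(2) opn(2) by auto
  thus ?thesis
    by eventually_elim (use V opn(2) h in \<open>auto simp: topspace_Euclidean_space\<close>)
qed

text \<open>
  The defining function vanishes at \<open>x\<close> and decreases along \<open>h\<close>, so it is negative on a short piece
  of the ray.
\<close>
lemma boundary_ray:
  assumes \<phi>: "local_defining_function n \<Omega> x U \<phi>" and x: "x \<in> Euclidean_space n frontier_of \<Omega>"
    and h: "h \<in> topspace (Euclidean_space n)" and inward: "(\<Sum>i<n. h i * partial i \<phi> x) < 0"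
  shows "\<forall>\<^sub>F t in at_right 0. (\<lambda>i. x i + t * h i) \<in> \<Omega>"
proof -
  have U: "openin (Euclidean_space n) U" "x \<in> U" and smooth: "smooth_on_open n U \<phi>"
    and in\<Omega>: "\<Omega> \<inter> U = {x \<in> U. \<phi> x < 0}"
    and fr: "(Euclidean_space n frontier_of \<Omega>) \<inter> U = {x \<in> U. \<phi> x = 0}"
    using \<phi> by (auto simp: local_defining_function_def)
  have "continuous_on U (partial i \<phi>)" if "i < n" for i
  proof -
    have "continuous_map (subtopology (Euclidean_space n) U) euclideanreal (iter_partial [i] \<phi>)"
      using smooth that unfolding smooth_on_open_def by auto
    thus ?thesis using U(1)
      by (simp add: continuous_map_Euclidean_subtopology openin_subset iter_partial_def)
  qed
  moreover have "((\<lambda>t. \<phi> (y(i := t))) has_real_derivative partial i \<phi> y) (at (y i))"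
    if "y \<in> U" "i < n" for y i
  proof -
    have "(\<lambda>t. iter_partial [] \<phi> (y(i := t))) differentiable (at (y i))"
      using smooth that unfolding smooth_on_open_def by (metis empty_subsetI list.set(1))
    thus ?thesis by (simp add: iter_partial_def partial_def DERIV_deriv_iff_real_differentiable)
  qed
  ultimately have "((\<lambda>t. \<phi> (\<lambda>i. x i + t * h i)) has_real_derivative (\<Sum>i<n. h i * partial i \<phi> x)) (at 0)"
    by (intro has_directional_derivative_at_0[OF U h])
  from DERIV_neg_dec_right[OF this inward] obtain d where "d > 0"
    and d: "\<And>t. t > 0 \<Longrightarrow> t < d \<Longrightarrow> \<phi> (\<lambda>i. x i + t * h i) < \<phi> x" by auto
  moreover have "\<phi> x = 0" using fr x U(2) by blast
  ultimately have "\<forall>\<^sub>F t in at_right 0. \<phi> (\<lambda>i. x i + t * h i) < 0"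
    by (auto simp: eventually_at_right_field)
  with interior_ray[OF U h] show ?thesis
    by eventually_elim (use in\<Omega> in blast)
qed

text \<open>
  On the boundary the Neumann condition says that the normal component of the extended gradient is
  zero, and every direction with a negative normal component enters \<open>\<Omega>\<close>. In the interior every
  direction enters, and any basis vector can play the role of the normal.
\<close>
lemma neumann_maximum:
  assumes n: "n \<ge> 1" and dom: "bounded_smooth_domain n \<Omega>" and jet: "C2_jet n \<Omega> f G H"
    and neumann: "neumann_zero n \<Omega> f"
    and x: "x \<in> Euclidean_space n closure_of \<Omega>"
    and max: "\<forall>y\<in>Euclidean_space n closure_of \<Omega>. f y \<le> f x"
    and k: "k < n"
  shows "G k x = 0" and "H k k x \<le> 0"
proof -
  have opn: "openin (Euclidean_space n) \<Omega>" using dom by (simp add: bounded_smooth_domain_def)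
  note ray = maximum_along_entering_ray[OF opn jet x max]
  note half = maximum_with_entering_half_space[OF opn jet x max _ _ _ _ k]
  have "G k x = 0 \<and> H k k x \<le> 0"
  proof (cases "x \<in> \<Omega>")
    case True
    note enter = interior_ray[OF opn True]
    define e where "e = (\<lambda>c (i::nat). if i = 0 then c else (0::real))"
    have e: "e c \<in> topspace (Euclidean_space n)" for c
      using n by (auto simp: e_def topspace_Euclidean_space)
    have e_sum: "(\<Sum>i<n. e c i * F i) = c * F 0" for c F
      using n by (simp add: e_def if_distrib [of "\<lambda>c. c * _"] cong: if_cong)
    have "c * G 0 x \<le> 0" for c
      using ray(2)[OF e enter[OF e]] by (simp add: e_sum)
    from this[of 1] this[of "-1"] have "(\<Sum>i<n. e 1 i * G i x) = 0" by (simp add: e_sum)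
    moreover have "e 1 \<noteq> (\<lambda>_. 0)" by (auto simp: e_def fun_eq_iff)
    ultimately show ?thesis using half[OF e] enter by blast
  next
    case False
    hence fr: "x \<in> Euclidean_space n frontier_of \<Omega>"
      using x opn by (simp add: frontier_of_def interior_of_openin)
    then obtain U \<phi> where \<phi>: "local_defining_function n \<Omega> x U \<phi>"
      using dom unfolding bounded_smooth_domain_def by blast
    define L where "L = L2_set (\<lambda>j. partial j \<phi> x) {..<n}"
    define \<nu> where "\<nu> = (\<lambda>i. if i < n then partial i \<phi> x / L else 0)"
    have \<nu>E: "\<nu> \<in> topspace (Euclidean_space n)" by (simp add: \<nu>_def topspace_Euclidean_space)
    obtain i where i: "i < n" "partial i \<phi> x \<noteq> 0"
      using \<phi> unfolding local_defining_function_def by blast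
    hence L: "L > 0" unfolding L_def L2_set_def by (auto intro!: sum_pos2[of _ i])
    have "\<nu> \<noteq> (\<lambda>_. 0)" using i L by (auto simp: \<nu>_def fun_eq_iff)
    have enter: "\<forall>\<^sub>F t in at_right 0. (\<lambda>i. x i + t * h i) \<in> \<Omega>"
      if "h \<in> topspace (Euclidean_space n)" "(\<Sum>i<n. h i * \<nu> i) < 0" for h
    proof (rule boundary_ray[OF \<phi> fr that(1)])
      have "(\<Sum>i<n. h i * \<nu> i) = (\<Sum>i<n. h i * partial i \<phi> x) / L"
        by (simp add: \<nu>_def sum_divide_distrib)
      thus "(\<Sum>i<n. h i * partial i \<phi> x) < 0" using that(2) L by (simp add: divide_less_0_iff)
    qed
    have "unit_outer_normal n \<Omega> x \<nu>" using \<phi> unfolding unit_outer_normal_def \<nu>_def L_def by blast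
    hence "((\<lambda>t. f (\<lambda>i. x i + t * \<nu> i)) has_real_derivative 0) (at_left 0)"
      using neumann fr by (auto simp: neumann_zero_def)
    hence "((\<lambda>t. (f (\<lambda>i. x i + t * \<nu> i) - f x) / t) \<longlongrightarrow> 0) (at_left 0)"
      by (simp add: has_field_derivative_iff)
    \<comment> \<open>Reflecting \<open>t\<close> turns the one-sided derivative along \<open>\<nu>\<close> into one along the entering ray
      in direction \<open>- \<nu>\<close>.\<close>
    hence "((\<lambda>t. (f (\<lambda>i. x i + (- t) * \<nu> i) - f x) / (- t)) \<longlongrightarrow> 0) (at_right 0)"
      by (subst (asm) filterlim_at_left_to_right) simp
    from tendsto_minus[OF this]
    have "((\<lambda>t. (f (\<lambda>i. x i + t * (- \<nu> i)) - f x) / t) \<longlongrightarrow> 0) (at_right 0)" by simp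
    moreover have "((\<lambda>t. (f (\<lambda>i. x i + t * (- \<nu> i)) - f x) / t) \<longlongrightarrow> (\<Sum>i<n. - \<nu> i * G i x)) (at_right 0)"
    proof (rule ray(1))
      show m\<nu>: "(\<lambda>i. - \<nu> i) \<in> topspace (Euclidean_space n)" by (simp add: \<nu>_def topspace_Euclidean_space)
      have "(\<Sum>i<n. \<nu> i * \<nu> i) > 0"
        using i L by (intro sum_pos2[of _ i]) (auto simp: \<nu>_def zero_less_divide_iff zero_less_mult_iff linorder_neq_iff)
      thus "\<forall>\<^sub>F t in at_right 0. (\<lambda>i. x i + t * - \<nu> i) \<in> \<Omega>"
        by (intro enter[OF m\<nu>]) (simp add: sum_negf)
    qed
    ultimately have "(\<Sum>i<n. - \<nu> i * G i x) = 0"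
      by (intro tendsto_unique[where F = "at_right (0::real)"]) auto
    hence "(\<Sum>i<n. \<nu> i * G i x) = 0" by (simp add: sum_negf)
    with half[OF \<nu>E \<open>\<nu> \<noteq> _\<close>] enter show ?thesis by blast
  qed
  thus "G k x = 0" and "H k k x \<le> 0" by auto
qed

section \<open>Maxima of logarithmic combinations of a solution\<close>

lemma C2_jet_log_combination:
  assumes opn: "openin (Euclidean_space n) \<Omega>"
    and u: "C2_jet n \<Omega> u Gu Hu" and v: "C2_jet n \<Omega> v Gv Hv"
    and pos: "\<forall>x\<in>Euclidean_space n closure_of \<Omega>. u x > 0 \<and> v x > 0"
  shows "C2_jet n \<Omega> (\<lambda>x. \<alpha> * ln (u x) + \<beta> * ln (v x))
    (\<lambda>i x. \<alpha> * (Gu i x / u x) + \<beta> * (Gv i x / v x))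
    (\<lambda>i j x. \<alpha> * (Hu i j x / u x - Gu i x / u x * (Gu j x / u x)) +
             \<beta> * (Hv i j x / v x - Gv i x / v x * (Gv j x / v x)))"
proof -
  have sub: "\<Omega> \<subseteq> Euclidean_space n closure_of \<Omega>"
    using opn by (simp add: closure_of_subset openin_subset)
  have pos\<Omega>: "u x > 0" "v x > 0" if "x \<in> \<Omega>" for x using pos sub that by auto
  have ne: "\<forall>x\<in>Euclidean_space n closure_of \<Omega>. u x \<noteq> 0" "\<forall>x\<in>Euclidean_space n closure_of \<Omega>. v x \<noteq> 0"
    using pos by force+
  have grad: "((\<lambda>t. \<alpha> * ln (u (x(i := t))) + \<beta> * ln (v (x(i := t)))) has_real_derivative
      \<alpha> * (Gu i x / u x) + \<beta> * (Gv i x / v x)) (at (x i))" if "x \<in> \<Omega>" "i < n" for x i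
  proof -
    have D: "((\<lambda>t. u (x(i := t))) has_real_derivative Gu i x) (at (x i))"
        "((\<lambda>t. v (x(i := t))) has_real_derivative Gv i x) (at (x i))"
      using u v that by (auto simp: C2_jet_def)
    have "((\<lambda>t. ln (u (x(i := t)))) has_real_derivative Gu i x / u x) (at (x i))"
      using DERIV_chain2[OF DERIV_ln_divide D(1)] pos\<Omega>[OF that(1)] by simp
    moreover have "((\<lambda>t. ln (v (x(i := t)))) has_real_derivative Gv i x / v x) (at (x i))"
      using DERIV_chain2[OF DERIV_ln_divide D(2)] pos\<Omega>[OF that(1)] by simp
    ultimately show ?thesis by (intro DERIV_add DERIV_cmult)
  qed
  have quot: "((\<lambda>t. F i (x(j := t)) / w (x(j := t))) has_real_derivative
      K i j x / w x - F i x / w x * (F j x / w x)) (at (x j))"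
    if jet: "C2_jet n \<Omega> w F K" and "w x \<noteq> 0" "x \<in> \<Omega>" "i < n" "j < n" for w F K x i j
  proof -
    have D: "((\<lambda>t. w (x(j := t))) has_real_derivative F j x) (at (x j))"
        "((\<lambda>t. F i (x(j := t))) has_real_derivative K i j x) (at (x j))"
      using that by (auto simp: C2_jet_def)
    show ?thesis
      using DERIV_divide[OF D(2) D(1)] \<open>w x \<noteq> 0\<close> by (simp add: field_simps)
  qed
  have hess: "((\<lambda>t. \<alpha> * (Gu i (x(j := t)) / u (x(j := t))) + \<beta> * (Gv i (x(j := t)) / v (x(j := t))))
      has_real_derivative
      \<alpha> * (Hu i j x / u x - Gu i x / u x * (Gu j x / u x)) +
      \<beta> * (Hv i j x / v x - Gv i x / v x * (Gv j x / v x))) (at (x j))"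
    if "x \<in> \<Omega>" "i < n" "j < n" for x i j
    using that pos\<Omega>[OF that(1)] by (intro DERIV_add DERIV_cmult quot u v) auto
  show ?thesis
    unfolding C2_jet_def
  proof (intro conjI allI impI ballI)
    show "continuous_on (Euclidean_space n closure_of \<Omega>) (\<lambda>x. \<alpha> * ln (u x) + \<beta> * ln (v x))"
      using u v ne by (auto simp: C2_jet_def intro!: continuous_intros)
    show "continuous_on (Euclidean_space n closure_of \<Omega>)
        (\<lambda>x. \<alpha> * (Gu i x / u x) + \<beta> * (Gv i x / v x))" if "i < n" for i
      using u v ne that by (auto simp: C2_jet_def intro!: continuous_intros)
    show "continuous_on (Euclidean_space n closure_of \<Omega>)
        (\<lambda>x. \<alpha> * (Hu i j x / u x - Gu i x / u x * (Gu j x / u x)) +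
             \<beta> * (Hv i j x / v x - Gv i x / v x * (Gv j x / v x)))" if "i < n" "j < n" for i j
      using u v ne that by (auto simp: C2_jet_def intro!: continuous_intros)
  qed (use grad hess in auto)
qed

lemma neumann_zero_log_combination:
  assumes u: "neumann_zero n \<Omega> u" and v: "neumann_zero n \<Omega> v"
    and pos: "\<forall>x\<in>Euclidean_space n closure_of \<Omega>. u x > 0 \<and> v x > 0"
  shows "neumann_zero n \<Omega> (\<lambda>x. \<alpha> * ln (u x) + \<beta> * ln (v x))"
  unfolding neumann_zero_def
proof (intro ballI allI impI)
  fix x \<nu> assume x: "x \<in> Euclidean_space n frontier_of \<Omega>" and \<nu>: "unit_outer_normal n \<Omega> x \<nu>"
  have D: "((\<lambda>t. u (\<lambda>i. x i + t * \<nu> i)) has_real_derivative 0) (at_left 0)"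
      "((\<lambda>t. v (\<lambda>i. x i + t * \<nu> i)) has_real_derivative 0) (at_left 0)"
    using u v x \<nu> by (auto simp: neumann_zero_def)
  have "u x > 0" "v x > 0" using pos x by (auto simp: frontier_of_def)
  thus "((\<lambda>t. \<alpha> * ln (u (\<lambda>i. x i + t * \<nu> i)) + \<beta> * ln (v (\<lambda>i. x i + t * \<nu> i)))
      has_real_derivative 0) (at_left 0)"
    by (auto intro!: derivative_eq_intros D)
qed

text \<open>
  Here \<open>\<xi>\<close> and \<open>\<eta>\<close> stand for \<open>\<nabla>u/u\<close> and \<open>\<nabla>v/v\<close> at a critical point. If \<open>\<beta> \<noteq> 0\<close>, then
  \<open>\<eta> = - (\<alpha>/\<beta>) \<xi>\<close> and the left hand side equals \<open>\<alpha> \<beta> (\<alpha> + \<beta>) |\<xi>/\<beta>|\<^sup>2\<close>.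
\<close>
lemma log_gradient_balance:
  fixes \<xi> \<eta> :: "nat \<Rightarrow> real"
  assumes crit: "\<And>i. i < n \<Longrightarrow> \<alpha> * \<xi> i + \<beta> * \<eta> i = 0" and sign: "\<alpha> * \<beta> * (\<alpha> + \<beta>) \<le> 0"
  shows "\<alpha> * (\<Sum>i<n. \<xi> i * \<xi> i) + \<beta> * (\<Sum>i<n. \<eta> i * \<eta> i) \<le> 0"
proof -
  have "\<alpha> * (\<xi> i * \<xi> i) + \<beta> * (\<eta> i * \<eta> i) \<le> 0" if "i < n" for i
  proof (cases "\<beta> = 0")
    case True
    thus ?thesis using crit[OF that] by auto
  next
    case False
    hence \<eta>: "\<eta> i = - \<alpha> * \<xi> i / \<beta>" using crit[OF that] by (simp add: field_simps)
    have "\<alpha> * (\<xi> i * \<xi> i) + \<beta> * (\<eta> i * \<eta> i) = \<alpha> * \<beta> * (\<alpha> + \<beta>) * (\<xi> i / \<beta>)\<^sup>2"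
      using False by (simp add: \<eta> field_simps power2_eq_square)
    also have "\<dots> \<le> 0" by (rule mult_nonpos_nonneg[OF sign]) simp
    finally show ?thesis .
  qed
  hence "(\<Sum>i<n. \<alpha> * (\<xi> i * \<xi> i) + \<beta> * (\<eta> i * \<eta> i)) \<le> 0" by (intro sum_nonpos) auto
  thus ?thesis by (simp add: sum.distrib sum_distrib_left)
qed

text \<open>
  The equations extend to the closure by continuity, so they may be used at a maximum point on the
  boundary. Dividing them by \<open>d\<^sub>1 u\<close> and \<open>d\<^sub>2 v\<close> expresses \<open>\<Delta>u/u\<close> and \<open>\<Delta>v/v\<close> through the
  quotients in the conclusion.
\<close>
lemma log_combination_maximum:
  assumes n: "n \<ge> 1" and dom: "bounded_smooth_domain n \<Omega>" and d: "d\<^sub>1 > 0" "d\<^sub>2 > 0"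
    and sol: "positive_smooth_solution n \<Omega> d\<^sub>1 d\<^sub>2 \<sigma> p q r s u v"
    and sign: "\<alpha> * \<beta> * (\<alpha> + \<beta>) \<le> 0"
  obtains x where "x \<in> Euclidean_space n closure_of \<Omega>"
    and "\<And>y. y \<in> Euclidean_space n closure_of \<Omega> \<Longrightarrow>
           \<alpha> * ln (u y) + \<beta> * ln (v y) \<le> \<alpha> * ln (u x) + \<beta> * ln (v x)"
    and "\<alpha> / d\<^sub>1 * (1 - u x powr (p - 1) / v x powr q - \<sigma> / u x) +
         \<beta> / d\<^sub>2 * (1 - u x powr r / v x powr (s + 1)) \<le> 0"
proof -
  let ?cl = "Euclidean_space n closure_of \<Omega>"
  have opn: "openin (Euclidean_space n) \<Omega>" and ne: "\<Omega> \<noteq> {}"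
    using dom by (auto simp: bounded_smooth_domain_def)
  have sub: "\<Omega> \<subseteq> ?cl" using opn by (simp add: closure_of_subset openin_subset)
  have cl: "?cl = closure \<Omega>" using opn by (simp add: closure_of_Euclidean_space openin_subset)
  have pos: "\<forall>x\<in>?cl. u x > 0 \<and> v x > 0" and neumann: "neumann_zero n \<Omega> u" "neumann_zero n \<Omega> v"
    and smooth: "smooth_on_closure n \<Omega> u" "smooth_on_closure n \<Omega> v"
    and pde: "\<And>x. x \<in> \<Omega> \<Longrightarrow> d\<^sub>1 * laplacian n u x - u x + u x powr p / v x powr q + \<sigma> = 0"
      "\<And>x. x \<in> \<Omega> \<Longrightarrow> d\<^sub>2 * laplacian n v x - v x + u x powr r / v x powr s = 0"
    using sol by (auto simp: positive_smooth_solution_def)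
  obtain Gu Hu where u: "C2_jet n \<Omega> u Gu Hu" and lap_u: "\<And>x. x \<in> \<Omega> \<Longrightarrow> laplacian n u x = (\<Sum>i<n. Hu i i x)"
    using smooth_on_closure_C2_jet[OF smooth(1)] by metis
  obtain Gv Hv where v: "C2_jet n \<Omega> v Gv Hv" and lap_v: "\<And>x. x \<in> \<Omega> \<Longrightarrow> laplacian n v x = (\<Sum>i<n. Hv i i x)"
    using smooth_on_closure_C2_jet[OF smooth(2)] by metis
  have ne0: "\<forall>x\<in>?cl. u x \<noteq> 0" "\<forall>x\<in>?cl. v x \<noteq> 0" using pos by force+
  have cont: "continuous_on ?cl (\<lambda>x. d\<^sub>1 * (\<Sum>i<n. Hu i i x) - u x + u x powr p / v x powr q + \<sigma>)"
      "continuous_on ?cl (\<lambda>x. d\<^sub>2 * (\<Sum>i<n. Hv i i x) - v x + u x powr r / v x powr s)"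
    using u v ne0 by (auto simp: C2_jet_def intro!: continuous_intros)
  have eq_u: "d\<^sub>1 * (\<Sum>i<n. Hu i i x) - u x + u x powr p / v x powr q + \<sigma> = 0" if "x \<in> ?cl" for x
    using continuous_constant_on_closure[OF cont(1)[unfolded cl], of 0 x] pde(1) that
    by (auto simp: cl lap_u)
  have eq_v: "d\<^sub>2 * (\<Sum>i<n. Hv i i x) - v x + u x powr r / v x powr s = 0" if "x \<in> ?cl" for x
    using continuous_constant_on_closure[OF cont(2)[unfolded cl], of 0 x] pde(2) that
    by (auto simp: cl lap_v)
  define f where "f = (\<lambda>x. \<alpha> * ln (u x) + \<beta> * ln (v x))"
  note jet = C2_jet_log_combination[OF opn u v pos, of \<alpha> \<beta>, folded f_def]
  have "continuous_on ?cl f" using jet by (simp add: C2_jet_def)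
  moreover have "?cl \<noteq> {}" using ne sub by auto
  ultimately obtain x where x: "x \<in> ?cl" and max: "\<forall>y\<in>?cl. f y \<le> f x"
    using continuous_attains_sup[OF compact_closure_of_bounded_smooth_domain[OF dom]] by metis
  note crit = neumann_maximum[OF n dom jet
    neumann_zero_log_combination[OF neumann pos, of \<alpha> \<beta>, folded f_def] x max]
  have ux: "u x > 0" and vx: "v x > 0" using pos x by auto
  have "(\<Sum>i<n. \<alpha> * (Hu i i x / u x - Gu i x / u x * (Gu i x / u x)) +
      \<beta> * (Hv i i x / v x - Gv i x / v x * (Gv i x / v x))) \<le> 0"
    by (intro sum_nonpos crit(2)) auto
  hence "\<alpha> * ((\<Sum>i<n. Hu i i x) / u x) + \<beta> * ((\<Sum>i<n. Hv i i x) / v x) \<le>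
      \<alpha> * (\<Sum>i<n. Gu i x / u x * (Gu i x / u x)) + \<beta> * (\<Sum>i<n. Gv i x / v x * (Gv i x / v x))"
    by (simp add: sum.distrib sum_subtractf right_diff_distrib sum_distrib_left sum_divide_distrib)
  also have "\<dots> \<le> 0" using crit(1) sign by (intro log_gradient_balance) auto
  finally have le: "\<alpha> * ((\<Sum>i<n. Hu i i x) / u x) + \<beta> * ((\<Sum>i<n. Hv i i x) / v x) \<le> 0" .
  have "(\<Sum>i<n. Hu i i x) / u x = (1 - u x powr (p - 1) / v x powr q - \<sigma> / u x) / d\<^sub>1"
  proof -
    have "(\<Sum>i<n. Hu i i x) = (u x - u x powr p / v x powr q - \<sigma>) / d\<^sub>1"
      using eq_u[OF x] d by (simp add: field_simps)
    thus ?thesis using ux by (simp add: powr_diff field_simps)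
  qed
  moreover have "(\<Sum>i<n. Hv i i x) / v x = (1 - u x powr r / v x powr (s + 1)) / d\<^sub>2"
  proof -
    have "(\<Sum>i<n. Hv i i x) = (v x - u x powr r / v x powr s) / d\<^sub>2"
      using eq_v[OF x] d by (simp add: field_simps)
    thus ?thesis using vx by (simp add: powr_add field_simps)
  qed
  ultimately have "\<alpha> / d\<^sub>1 * (1 - u x powr (p - 1) / v x powr q - \<sigma> / u x) +
      \<beta> / d\<^sub>2 * (1 - u x powr r / v x powr (s + 1)) \<le> 0"
    using le by simp
  thus ?thesis using that[of x] x max by (auto simp: f_def)
qed

section \<open>Real inequalities\<close>

text \<open>
  \<open>(M, N)\<close> are the values of \<open>(u, v)\<close> where \<open>u\<close> is largest and \<open>(U, V)\<close> those where \<open>u\<^sup>k/v\<close> is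
  largest. With \<open>w = U\<^sup>k/V\<close>, \<open>A = k(s+1) - r\<close> and \<open>B = kQ - a\<close>, the inequality at \<open>M\<close> reads
  \<open>M\<^sup>B \<le> K w\<^sup>Q\<close>. Multiplying the inequality at \<open>U\<close> by \<open>U\<^sup>A\<close> and using
  \<open>0 \<le> A\<close>, \<open>B \<le> A\<close> and \<open>U \<le> M\<close> gives \<open>w\<close> to the power \<open>s + 1 - Q\<close> at most
  \<open>(K + T) M\<close> to the power \<open>A - B\<close>. Eliminating \<open>w\<close> leaves the exponent \<open>r - a (s+1)/Q\<close> on \<open>M\<close>,
  which is positive and independent of \<open>k\<close>.
\<close>
lemma activator_bound_from_extrema:
  fixes M N U V :: real
  assumes pos: "M > 0" "N > 0" "U > 0" "V > 0"
    and exps: "Q > 0" "Q < s + 1" "a * (s + 1) / Q < r"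
    and k: "r \<le> k * (s + 1)" "r - a \<le> k * (s + 1 - Q)"
    and const: "K > 0" "T \<ge> 0"
    and UM: "U \<le> M"
    and quot: "M powr k / N \<le> U powr k / V"
    and at_M: "N powr Q \<le> K * M powr a"
    and at_U: "U powr r / V powr (s + 1) \<le> 1 + T * (U powr a / V powr Q)"
  shows "M \<le> (K powr ((s + 1) / Q - 1) * (K + T)) powr (1 / (r - a * (s + 1) / Q))"
proof -
  define w where "w = U powr k / V"
  define A where "A = k * (s + 1) - r"
  define B where "B = k * Q - a"
  have w: "w > 0" using pos by (simp add: w_def)
  have wpow: "w powr x = U powr (k * x) / V powr x" for x
    using pos by (simp add: w_def powr_divide powr_powr)
  have A: "A \<ge> 0" and AB: "A - B \<ge> 0" using k by (auto simp: A_def B_def algebra_simps)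
  have MB: "M powr B \<le> K * w powr Q"
  proof -
    have "(M powr k / N) powr Q \<le> w powr Q"
      using quot pos exps by (intro powr_mono2) (auto simp: w_def)
    hence "M powr (k * Q) \<le> w powr Q * N powr Q"
      using pos by (simp add: powr_divide powr_powr field_simps)
    also have "\<dots> \<le> w powr Q * (K * M powr a)"
      using at_M by (intro mult_left_mono) auto
    finally show ?thesis
      using pos by (simp add: B_def powr_diff field_simps)
  qed
  have "w powr (s + 1) = U powr r / V powr (s + 1) * U powr A"
    unfolding wpow by (simp add: A_def powr_add [symmetric])
  also have "\<dots> \<le> (1 + T * (U powr a / V powr Q)) * U powr A"
    using at_U by (intro mult_right_mono) auto
  also have "\<dots> = U powr A + T * w powr Q * U powr (A - B)"
  proof -
    have "U powr a * U powr A = U powr (k * Q) * U powr (A - B)"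
      by (simp add: powr_add [symmetric] B_def algebra_simps)
    thus ?thesis by (simp add: wpow algebra_simps)
  qed
  also have "\<dots> \<le> M powr A + T * w powr Q * M powr (A - B)"
    using A AB UM pos const by (intro add_mono mult_left_mono powr_mono2) auto
  also have "\<dots> = M powr (A - B) * (M powr B + T * w powr Q)"
    by (simp add: algebra_simps powr_add [symmetric])
  also have "\<dots> \<le> M powr (A - B) * (K * w powr Q + T * w powr Q)"
    using MB by (intro mult_left_mono add_right_mono) auto
  finally have "w powr (s + 1) \<le> ((K + T) * M powr (A - B)) * w powr Q"
    by (simp add: algebra_simps)
  hence wle: "w powr (s + 1 - Q) \<le> (K + T) * M powr (A - B)"
    using w by (simp add: powr_diff field_simps)
  define e where "e = (s + 1) / Q - 1"
  have e: "e \<ge> 0" using exps by (simp add: e_def field_simps)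
  have "M powr (B * e) = (M powr B) powr e" by (simp add: powr_powr)
  also have "\<dots> \<le> (K * w powr Q) powr e"
    using MB e by (intro powr_mono2) auto
  also have "\<dots> = K powr e * w powr (s + 1 - Q)"
  proof -
    have "Q * e = s + 1 - Q" using exps by (simp add: e_def field_simps)
    thus ?thesis using const by (simp add: powr_mult powr_powr)
  qed
  also have "\<dots> \<le> K powr e * ((K + T) * M powr (A - B))"
    using wle by (intro mult_left_mono) auto
  finally have "M powr (B * e - (A - B)) \<le> K powr e * (K + T)"
    using pos by (subst powr_diff) (simp add: divide_simps mult_ac)
  moreover have "B * e - (A - B) = r - a * (s + 1) / Q"
    using exps by (simp add: A_def B_def e_def field_simps)
  ultimately have MD: "M powr (r - a * (s + 1) / Q) \<le> K powr e * (K + T)" by simp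
  have "M = (M powr (r - a * (s + 1) / Q)) powr (1 / (r - a * (s + 1) / Q))"
    using pos exps by (simp add: powr_powr)
  also have "\<dots> \<le> (K powr e * (K + T)) powr (1 / (r - a * (s + 1) / Q))"
    using MD exps by (intro powr_mono2) auto
  finally show ?thesis by (simp add: e_def)
qed

lemma powr_one_plus_le:
  fixes x g :: real
  assumes "x \<ge> 0" "g > 0"
  shows "(1 + x) powr g \<le> 2 powr g * (1 + x powr g)"
proof -
  have "(1 + x) powr g \<le> (2 * max 1 x) powr g"
    using assms by (intro powr_mono2) auto
  also have "\<dots> = 2 powr g * max 1 x powr g" using assms by (simp add: powr_mult)
  also have "max 1 x powr g \<le> 1 + x powr g" by (auto simp: max_def)
  finally show ?thesis by simp
qed

lemma powr_affine_le:
  fixes x k g :: real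
  assumes "x \<ge> 0" "k \<ge> 1" "g > 0"
  shows "(1 + k * x) powr g \<le> (2 * k) powr g * (1 + x powr g)"
proof -
  have "(1 + k * x) powr g \<le> (k * (1 + x)) powr g"
    using assms by (intro powr_mono2) (auto simp: algebra_simps)
  also have "\<dots> = k powr g * (1 + x) powr g" using assms by (simp add: powr_mult)
  also have "\<dots> \<le> k powr g * (2 powr g * (1 + x powr g))"
    using assms by (intro mult_left_mono powr_one_plus_le) auto
  finally show ?thesis using assms by (simp add: powr_mult algebra_simps)
qed

section \<open>Bounds for solutions\<close>

text \<open>
  Each of the following bounds evaluates \<open>log_combination_maximum\<close> for one or two choices of
  \<open>(\<alpha>, \<beta>)\<close>, for the same solution.
\<close>
locale neumann_solution =
  fixes n :: nat and \<Omega> :: "(nat \<Rightarrow> real) set" and d\<^sub>1 d\<^sub>2 \<sigma> p q r s :: real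
    and u v :: "(nat \<Rightarrow> real) \<Rightarrow> real"
  assumes n: "n \<ge> 1" and dom: "bounded_smooth_domain n \<Omega>" and d: "d\<^sub>1 > 0" "d\<^sub>2 > 0"
    and sol: "positive_smooth_solution n \<Omega> d\<^sub>1 d\<^sub>2 \<sigma> p q r s u v"
    and rs: "r > 0" "s \<ge> 0"
begin

abbreviation cl :: "(nat \<Rightarrow> real) set" where "cl \<equiv> Euclidean_space n closure_of \<Omega>"

lemma pos: "x \<in> cl \<Longrightarrow> u x > 0" "x \<in> cl \<Longrightarrow> v x > 0"
  using sol by (auto simp: positive_smooth_solution_def)

lemmas log_max = log_combination_maximum[OF n dom d sol]

lemma activator_maximum:
  obtains x where "x \<in> cl" "\<And>y. y \<in> cl \<Longrightarrow> u y \<le> u x"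
    "1 \<le> u x powr (p - 1) / v x powr q + \<sigma> / u x"
proof -
  obtain x where x: "x \<in> cl" "\<And>y. y \<in> cl \<Longrightarrow> ln (u y) \<le> ln (u x)"
      "1 / d\<^sub>1 * (1 - u x powr (p - 1) / v x powr q - \<sigma> / u x) \<le> 0"
    using log_max[of 1 0] by auto
  have "u y \<le> u x" if "y \<in> cl" for y using x(2)[OF that] pos x(1) that by simp
  moreover have "1 \<le> u x powr (p - 1) / v x powr q + \<sigma> / u x"
    using x(3) d by (simp add: divide_le_0_iff)
  ultimately show ?thesis using that x(1) by blast
qed

lemma activator_minimum:
  obtains x where "x \<in> cl" "\<And>y. y \<in> cl \<Longrightarrow> u x \<le> u y"
    "u x powr (p - 1) / v x powr q + \<sigma> / u x \<le> 1"
proof -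
  obtain x where x: "x \<in> cl" "\<And>y. y \<in> cl \<Longrightarrow> ln (u x) \<le> ln (u y)"
      "- 1 / d\<^sub>1 * (1 - u x powr (p - 1) / v x powr q - \<sigma> / u x) \<le> 0"
    using log_max[of "-1" 0] by auto
  have "u x \<le> u y" if "y \<in> cl" for y using x(2)[OF that] pos x(1) that by simp
  moreover have "u x powr (p - 1) / v x powr q + \<sigma> / u x \<le> 1"
    using x(3) d by (simp add: zero_le_divide_iff)
  ultimately show ?thesis using that x(1) by blast
qed

lemma activator_ge_source: "y \<in> cl \<Longrightarrow> \<sigma> \<le> u y"
proof -
  assume y: "y \<in> cl"
  obtain x where x: "x \<in> cl" "u x \<le> u y" "u x powr (p - 1) / v x powr q + \<sigma> / u x \<le> 1"
    using activator_minimum y by metis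
  have "u x powr (p - 1) / v x powr q \<ge> 0" by simp
  hence "\<sigma> / u x \<le> 1" using x(3) by linarith
  hence "\<sigma> \<le> u x" using pos(1)[OF x(1)] by (simp add: field_simps)
  thus ?thesis using x(2) by linarith
qed

text \<open>At the maximum of \<open>v\<close> the second equation gives \<open>v\<^sup>s\<^sup>+\<^sup>1 \<le> u\<^sup>r\<close>.\<close>
lemma inhibitor_le:
  assumes M: "\<And>y. y \<in> cl \<Longrightarrow> u y \<le> M" and y: "y \<in> cl"
  shows "v y \<le> M powr (r / (s + 1))"
proof -
  obtain x where x: "x \<in> cl" "\<And>y. y \<in> cl \<Longrightarrow> ln (v y) \<le> ln (v x)"
      "1 / d\<^sub>2 * (1 - u x powr r / v x powr (s + 1)) \<le> 0"
    using log_max[of 0 1] by auto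
  have "1 \<le> u x powr r / v x powr (s + 1)" using x(3) d by (simp add: divide_le_0_iff)
  hence "v x powr (s + 1) \<le> u x powr r" using pos[OF x(1)] by simp
  also have "\<dots> \<le> M powr r" using M[OF x(1)] pos(1)[OF x(1)] rs by (intro powr_mono2) auto
  finally have "(v x powr (s + 1)) powr (1 / (s + 1)) \<le> (M powr r) powr (1 / (s + 1))"
    using rs by (intro powr_mono2) auto
  hence "v x \<le> M powr (r / (s + 1))" using pos(2)[OF x(1)] rs by (simp add: powr_powr)
  moreover have "v y \<le> v x" using x(2)[OF y] pos x(1) y by simp
  ultimately show ?thesis by linarith
qed

lemma inhibitor_ge:
  assumes m: "\<And>y. y \<in> cl \<Longrightarrow> m \<le> u y" "m \<ge> 0" and y: "y \<in> cl"
  shows "m powr (r / (s + 1)) \<le> v y"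
proof -
  obtain x where x: "x \<in> cl" "\<And>y. y \<in> cl \<Longrightarrow> ln (v x) \<le> ln (v y)"
      "- 1 / d\<^sub>2 * (1 - u x powr r / v x powr (s + 1)) \<le> 0"
    using log_max[of 0 "-1"] by auto
  have "u x powr r / v x powr (s + 1) \<le> 1" using x(3) d by (simp add: zero_le_divide_iff)
  hence "u x powr r \<le> v x powr (s + 1)" using pos[OF x(1)] by simp
  moreover have "m powr r \<le> u x powr r" using m x(1) rs by (intro powr_mono2) auto
  ultimately have "m powr r \<le> v x powr (s + 1)" by linarith
  hence "(m powr r) powr (1 / (s + 1)) \<le> (v x powr (s + 1)) powr (1 / (s + 1))"
    using rs by (intro powr_mono2) auto
  hence "m powr (r / (s + 1)) \<le> v x" using pos(2)[OF x(1)] rs by (simp add: powr_powr)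
  moreover have "v x \<le> v y" using x(2)[OF y] pos x(1) y by simp
  ultimately show ?thesis by linarith
qed

text \<open>
  The comparison hypothesis allows an exponent \<open>Q\<close> different from \<open>q\<close>: in the estimate, \<open>Q\<close> has to be
  smaller than \<open>s + 1\<close>. At the maximum of \<open>u\<close> either \<open>u \<le> 2\<sigma>\<close> or the source accounts for at most half
  of \<open>u\<close>, whence the factor \<open>2L\<close>.
\<close>
lemma activator_le:
  assumes exps: "Q > 0" "Q < s + 1" "(p - 1) * (s + 1) / Q < r"
    and k: "k \<ge> 1" "r \<le> k * (s + 1)" "r - (p - 1) \<le> k * (s + 1 - Q)"
    and L: "L > 0"
    and comparison: "\<And>y. y \<in> cl \<Longrightarrow> u y powr (p - 1) / v y powr q \<le> L * (u y powr (p - 1) / v y powr Q)"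
    and y: "y \<in> cl"
  shows "u y \<le> max (2 * \<sigma>) (((2 * L) powr ((s + 1) / Q - 1) * (2 * L + k * L * (d\<^sub>2 / d\<^sub>1)))
                powr (1 / (r - (p - 1) * (s + 1) / Q)))"
proof -
  obtain x where x: "x \<in> cl" "\<And>y. y \<in> cl \<Longrightarrow> u y \<le> u x"
      "1 \<le> u x powr (p - 1) / v x powr q + \<sigma> / u x"
    using activator_maximum by blast
  show ?thesis
  proof (cases "u x \<le> 2 * \<sigma>")
    case True
    thus ?thesis using x(2)[OF y] by simp
  next
    case False
    have "\<sigma> / u x \<le> 1 / 2" using False pos(1)[OF x(1)] by (simp add: field_simps)
    hence "1 / 2 \<le> L * (u x powr (p - 1) / v x powr Q)"
      using x(3) comparison[OF x(1)] by linarith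
    hence at_x: "v x powr Q \<le> 2 * L * u x powr (p - 1)"
      using pos[OF x(1)] by (simp add: field_simps)
    have "k * (-1) * (k + (-1)) \<le> 0" using k(1) by simp
    then obtain z where z: "z \<in> cl" "k * ln (u x) - ln (v x) \<le> k * ln (u z) - ln (v z)"
        "k / d\<^sub>1 * (1 - u z powr (p - 1) / v z powr q - \<sigma> / u z)
          - 1 / d\<^sub>2 * (1 - u z powr r / v z powr (s + 1)) \<le> 0"
      using log_max[of k "-1"] x(1) by auto
    note posz = pos[OF z(1)] and posx = pos[OF x(1)]
    have "ln (u x powr k / v x) \<le> ln (u z powr k / v z)"
      using z(2) posz posx by (simp add: ln_div ln_powr)
    hence quot: "u x powr k / v x \<le> u z powr k / v z" using posz posx by simp
    have "k / d\<^sub>1 * (\<sigma> / u z) \<le> k / d\<^sub>1 * 1"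
      using activator_ge_source[OF z(1)] posz k d by (intro mult_left_mono) auto
    hence "1 / d\<^sub>2 * (u z powr r / v z powr (s + 1)) \<le> 1 / d\<^sub>2 + k / d\<^sub>1 * (u z powr (p - 1) / v z powr q)"
      using z(3) unfolding right_diff_distrib by linarith
    also have "k / d\<^sub>1 * (u z powr (p - 1) / v z powr q) \<le> k / d\<^sub>1 * (L * (u z powr (p - 1) / v z powr Q))"
      using comparison[OF z(1)] k d by (intro mult_left_mono) auto
    finally have "d\<^sub>2 * (1 / d\<^sub>2 * (u z powr r / v z powr (s + 1)))
        \<le> d\<^sub>2 * (1 / d\<^sub>2 + k / d\<^sub>1 * (L * (u z powr (p - 1) / v z powr Q)))"
      using d by (intro mult_left_mono) auto
    hence at_z: "u z powr r / v z powr (s + 1) \<le>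
        1 + (k * L * (d\<^sub>2 / d\<^sub>1)) * (u z powr (p - 1) / v z powr Q)"
      using d by (simp add: distrib_left mult_ac)
    have "u x \<le> ((2 * L) powr ((s + 1) / Q - 1) * (2 * L + k * L * (d\<^sub>2 / d\<^sub>1)))
                powr (1 / (r - (p - 1) * (s + 1) / Q))"
      using k L d by (intro activator_bound_from_extrema[OF posx posz exps k(2,3) _ _ x(2)[OF z(1)] quot at_x at_z]) auto
    thus ?thesis using x(2)[OF y] by simp
  qed
qed

text \<open>
  With \<open>k = r/(s+1)\<close> the quotient \<open>v/u\<^sup>k\<close> is a negative power of \<open>u\<^sup>r/v\<^sup>s\<^sup>+\<^sup>1\<close>, and the latter is at
  least \<open>c = 1 - k d\<^sub>2/d\<^sub>1\<close> where \<open>v/u\<^sup>k\<close> is largest. Inserting the resulting bound for \<open>v\<close> into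
  \<open>u\<^sup>p\<^sup>-\<^sup>1 \<le> v\<^sup>q\<close> at the minimum of \<open>u\<close> leaves the positive exponent \<open>k q - (p - 1)\<close>.
\<close>
lemma activator_ge:
  assumes \<sigma>: "\<sigma> = 0" and q: "q \<ge> 0" and r: "r < s + 1" and \<tau>: "r / (s + 1) * (d\<^sub>2 / d\<^sub>1) < 1"
    and E: "p - 1 < r / (s + 1) * q"
    and y: "y \<in> cl"
  shows "(1 - r / (s + 1) * (d\<^sub>2 / d\<^sub>1)) powr (q / (s + 1) / (r / (s + 1) * q - (p - 1))) \<le> u y"
proof -
  define k where "k = r / (s + 1)"
  define c where "c = 1 - k * (d\<^sub>2 / d\<^sub>1)"
  have k: "0 \<le> k" "k \<le> 1" using rs r by (auto simp: k_def)
  have c: "c > 0" using \<tau> by (simp add: c_def k_def)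
  have "(- k) * 1 * (- k + 1) \<le> 0" using k by (simp add: mult_nonneg_nonneg)
  then obtain z where z: "z \<in> cl"
      "\<And>x. x \<in> cl \<Longrightarrow> - (k * ln (u x)) + ln (v x) \<le> - (k * ln (u z)) + ln (v z)"
      "- k / d\<^sub>1 * (1 - u z powr (p - 1) / v z powr q)
        + 1 / d\<^sub>2 * (1 - u z powr r / v z powr (s + 1)) \<le> 0"
    using log_max[of "- k" 1] \<sigma> by auto
  note posz = pos[OF z(1)]
  have "d\<^sub>2 * (- k / d\<^sub>1 * (1 - u z powr (p - 1) / v z powr q)
        + 1 / d\<^sub>2 * (1 - u z powr r / v z powr (s + 1))) \<le> 0"
    using z(3) d by (intro mult_nonneg_nonpos) auto
  hence "1 - u z powr r / v z powr (s + 1) \<le> k * (d\<^sub>2 / d\<^sub>1) * (1 - u z powr (p - 1) / v z powr q)"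
    using d by (simp add: distrib_left right_diff_distrib mult_ac)
  also have "\<dots> \<le> k * (d\<^sub>2 / d\<^sub>1) * 1" using k d by (intro mult_left_mono) auto
  finally have "c \<le> u z powr r / v z powr (s + 1)" by (simp add: c_def)
  hence "v z powr (s + 1) \<le> u z powr r / c" using c posz by (simp add: field_simps)
  hence "(v z powr (s + 1)) powr (1 / (s + 1)) \<le> (u z powr r / c) powr (1 / (s + 1))"
    using rs by (intro powr_mono2) auto
  hence "v z \<le> u z powr k / c powr (1 / (s + 1))"
    using rs posz c by (simp add: powr_powr powr_divide k_def)
  hence vz: "v z / u z powr k \<le> 1 / c powr (1 / (s + 1))" using posz c by (simp add: field_simps)
  have v_le: "v x \<le> u x powr k / c powr (1 / (s + 1))" if x: "x \<in> cl" for x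
  proof -
    have "ln (v x / u x powr k) \<le> ln (v z / u z powr k)"
      using z(2)[OF x] pos[OF x] posz by (simp add: ln_div ln_powr)
    hence "v x / u x powr k \<le> v z / u z powr k" using pos[OF x] posz by simp
    with vz have "v x / u x powr k \<le> 1 / c powr (1 / (s + 1))" by linarith
    thus ?thesis using pos[OF x] c by (simp add: field_simps)
  qed
  obtain x where x: "x \<in> cl" "u x \<le> u y" "u x powr (p - 1) / v x powr q \<le> 1"
    using activator_minimum y \<sigma> by (metis add.right_neutral div_0)
  note posx = pos[OF x(1)]
  define e where "e = k * q - (p - 1)"
  have e: "e > 0" using E by (simp add: e_def k_def)
  have "u x powr (p - 1) \<le> v x powr q" using x(3) posx by simp
  also have "\<dots> \<le> (u x powr k / c powr (1 / (s + 1))) powr q"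
    using v_le[OF x(1)] posx q by (intro powr_mono2) auto
  also have "\<dots> = u x powr (k * q) / c powr (q / (s + 1))"
    using posx c by (simp add: powr_divide powr_powr)
  finally have "c powr (q / (s + 1)) \<le> u x powr (k * q) / u x powr (p - 1)"
    using posx c by (simp add: divide_simps mult_ac)
  hence "c powr (q / (s + 1)) \<le> u x powr e" unfolding e_def powr_diff [of _ "k * q"] .
  hence "(c powr (q / (s + 1))) powr (1 / e) \<le> (u x powr e) powr (1 / e)"
    using e by (intro powr_mono2) auto
  hence "c powr (q / (s + 1) / e) \<le> u x" using e posx by (simp add: powr_powr)
  thus ?thesis using x(2) by (simp add: c_def e_def k_def)
qed

end

text \<open>
  The bound of \<open>activator_le\<close> involves \<open>d\<^sub>1\<close> and \<open>d\<^sub>2\<close> only through a power of an affine function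
  of \<open>d\<^sub>2/d\<^sub>1\<close>, with an exponent \<open>\<gamma>\<close> that depends on \<open>p\<close>, \<open>r\<close>, \<open>s\<close> and \<open>Q\<close>. Raising it to the power
  \<open>r/(s+1)\<close> bounds \<open>v\<close>.
\<close>
lemma uniform_upper_bounds:
  fixes p q r s \<sigma> Q L :: real
  assumes rs: "r > 0" "s \<ge> 0" and \<sigma>: "\<sigma> \<ge> 0"
    and exps: "Q > 0" "Q < s + 1" "(p - 1) * (s + 1) / Q < r" and L: "L > 0"
  shows "\<exists>c>0. \<exists>\<gamma>>0. \<forall>n \<Omega> d\<^sub>1 d\<^sub>2 u v.
    neumann_solution n \<Omega> d\<^sub>1 d\<^sub>2 \<sigma> p q r s u v \<longrightarrow>
    (\<forall>x \<in> Euclidean_space n closure_of \<Omega>.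
       u x powr (p - 1) / v x powr q \<le> L * (u x powr (p - 1) / v x powr Q)) \<longrightarrow>
    (\<forall>x \<in> Euclidean_space n closure_of \<Omega>.
       u x \<le> c * (1 + (d\<^sub>2 / d\<^sub>1) powr \<gamma>) \<and>
       v x \<le> c * (1 + (d\<^sub>2 / d\<^sub>1) powr (r / (s + 1) * \<gamma>)))"
proof -
  define k where "k = max 1 (max (r / (s + 1)) ((r - (p - 1)) / (s + 1 - Q)))"
  have k: "k \<ge> 1" "r \<le> k * (s + 1)" "r - (p - 1) \<le> k * (s + 1 - Q)"
    using rs exps by (auto simp: k_def pos_divide_le_eq [symmetric])
  define \<gamma> where "\<gamma> = 1 / (r - (p - 1) * (s + 1) / Q)"
  have \<gamma>: "\<gamma> > 0" using exps by (simp add: \<gamma>_def)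
  define e where "e = r / (s + 1)"
  have e: "e > 0" using rs by (simp add: e_def)
  define C where "C = 2 * \<sigma> + ((2 * L) powr ((s + 1) / Q - 1) * (2 * L)) powr \<gamma> * (2 * k) powr \<gamma>"
  have C: "C > 0" using \<sigma> L k by (simp add: C_def add_nonneg_pos)
  have bounds: "u x \<le> C * (1 + (d\<^sub>2 / d\<^sub>1) powr \<gamma>)" "v x \<le> (C powr e * 2 powr e) * (1 + (d\<^sub>2 / d\<^sub>1) powr (e * \<gamma>))"
    if sol: "neumann_solution n \<Omega> d\<^sub>1 d\<^sub>2 \<sigma> p q r s u v"
    and comparison: "\<forall>x \<in> Euclidean_space n closure_of \<Omega>.
       u x powr (p - 1) / v x powr q \<le> L * (u x powr (p - 1) / v x powr Q)"
    and x: "x \<in> Euclidean_space n closure_of \<Omega>" for n \<Omega> d\<^sub>1 d\<^sub>2 u v x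
  proof -
    interpret neumann_solution n \<Omega> d\<^sub>1 d\<^sub>2 \<sigma> p q r s u v by (rule sol)
    define \<tau> where "\<tau> = d\<^sub>2 / d\<^sub>1"
    have \<tau>: "\<tau> > 0" using d by (simp add: \<tau>_def)
    have main: "u y \<le> C * (1 + \<tau> powr \<gamma>)" if y: "y \<in> cl" for y
    proof -
      let ?B = "((2 * L) powr ((s + 1) / Q - 1) * (2 * L + k * L * \<tau>)) powr \<gamma>"
      have "u y \<le> max (2 * \<sigma>) ?B"
        using activator_le[OF exps k L _ y] comparison by (simp add: \<tau>_def \<gamma>_def)
      also have "\<dots> \<le> 2 * \<sigma> + ?B" using \<sigma> by simp
      also have "?B \<le> ((2 * L) powr ((s + 1) / Q - 1) * (2 * L) * (1 + k * \<tau>)) powr \<gamma>"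
      proof -
        have "2 * L + k * L * \<tau> \<le> 2 * L * (1 + k * \<tau>)" using L k \<tau> by (simp add: algebra_simps)
        hence "(2 * L) powr ((s + 1) / Q - 1) * (2 * L + k * L * \<tau>) \<le>
            (2 * L) powr ((s + 1) / Q - 1) * (2 * L * (1 + k * \<tau>))" by (intro mult_left_mono) auto
        thus ?thesis using L k \<tau> \<gamma> by (intro powr_mono2) (auto simp: mult.assoc)
      qed
      also have "\<dots> = ((2 * L) powr ((s + 1) / Q - 1) * (2 * L)) powr \<gamma> * (1 + k * \<tau>) powr \<gamma>"
        using L k \<tau> by (subst powr_mult) auto
      also have "\<dots> \<le> ((2 * L) powr ((s + 1) / Q - 1) * (2 * L)) powr \<gamma> * ((2 * k) powr \<gamma> * (1 + \<tau> powr \<gamma>))"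
        using k \<tau> \<gamma> by (intro mult_left_mono powr_affine_le) auto
      also have "2 * \<sigma> + \<dots> \<le> C * (1 + \<tau> powr \<gamma>)"
        using \<sigma> by (simp add: C_def algebra_simps)
      finally show ?thesis by simp
    qed
    show "u x \<le> C * (1 + (d\<^sub>2 / d\<^sub>1) powr \<gamma>)" using main[OF x] by (simp add: \<tau>_def)
    have "v x \<le> (C * (1 + \<tau> powr \<gamma>)) powr e"
      using inhibitor_le[OF main x] by (simp add: e_def)
    also have "\<dots> = C powr e * (1 + \<tau> powr \<gamma>) powr e" using C by (simp add: powr_mult)
    also have "\<dots> \<le> C powr e * (2 powr e * (1 + (\<tau> powr \<gamma>) powr e))"
      using e by (intro mult_left_mono powr_one_plus_le) auto
    finally show "v x \<le> (C powr e * 2 powr e) * (1 + (d\<^sub>2 / d\<^sub>1) powr (e * \<gamma>))"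
      by (simp add: powr_powr \<tau>_def mult_ac)
  qed
  define c where "c = max C (C powr e * 2 powr e)"
  have enlarge: "b \<le> c * (1 + t powr a)" if "b \<le> c' * (1 + t powr a)" "c' \<le> c" for b c' t a
    using that(1) mult_right_mono[OF that(2), of "1 + t powr a"] by (simp add: add_nonneg_nonneg)
  show ?thesis
  proof (rule exI[of _ c], intro conjI, goal_cases)
    case 1
    show ?case using C by (simp add: c_def less_max_iff_disj)
  next
    case 2
    have "C \<le> c" "C powr e * 2 powr e \<le> c" by (auto simp: c_def)
    thus ?case
      using \<gamma> by (auto simp: e_def [symmetric] intro!: exI[of _ \<gamma>] elim!: enlarge[OF bounds(1)] enlarge[OF bounds(2)])
  qed
qed

section \<open>The a priori estimates\<close>

theorem theorem1p3:
  fixes p q r s :: real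
  assumes "p \<ge> 0" "q \<ge> 0" "r \<ge> 0" "s \<ge> 0"
    and "0 < (p - 1) / r" "(p - 1) / r < q / (s + 1)"
  shows
    "(q < s + 1 \<longrightarrow>
        (\<forall>n \<Omega>. n \<ge> 1 \<and> bounded_smooth_domain n \<Omega> \<longrightarrow>
          (\<exists>c>0. \<exists>\<gamma>>0. \<forall>d\<^sub>1>0. \<forall>d\<^sub>2>0. \<forall>u v.
             positive_smooth_solution n \<Omega> d\<^sub>1 d\<^sub>2 0 p q r s u v \<longrightarrow>
             (\<forall>x \<in> Euclidean_space n closure_of \<Omega>.
                u x \<le> c * (1 + (d\<^sub>2 / d\<^sub>1) powr \<gamma>) \<and>
                v x \<le> c * (1 + (d\<^sub>2 / d\<^sub>1) powr (r / (s + 1) * \<gamma>))))))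
     \<and>
     (\<exists>c :: real \<Rightarrow> real.
        (\<forall>\<tau>>0. max 1 \<tau> * r < s + 1 \<longrightarrow> c \<tau> > 0) \<and>
        (\<forall>n \<Omega> d\<^sub>1 d\<^sub>2 u v.
           n \<ge> 1 \<and> bounded_smooth_domain n \<Omega> \<and> d\<^sub>1 > 0 \<and> d\<^sub>2 > 0 \<and>
           max 1 (d\<^sub>2 / d\<^sub>1) * r < s + 1 \<and>
           positive_smooth_solution n \<Omega> d\<^sub>1 d\<^sub>2 0 p q r s u v \<longrightarrow>
           (\<forall>x \<in> Euclidean_space n closure_of \<Omega>.
              u x \<ge> c (d\<^sub>2 / d\<^sub>1) \<and> v x \<ge> c (d\<^sub>2 / d\<^sub>1) powr (r / (s + 1)))) \<and>
        (c \<longlongrightarrow> 0) (at ((s + 1) / r) within {\<tau>. 0 < \<tau> \<and> max 1 \<tau> * r < s + 1}))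
     \<and>
     (\<forall>\<sigma>>0. p - 1 < r \<longrightarrow>
        (\<forall>n \<Omega>. n \<ge> 1 \<and> bounded_smooth_domain n \<Omega> \<longrightarrow>
          (\<exists>c>0. \<exists>\<gamma>>0. \<forall>d\<^sub>1>0. \<forall>d\<^sub>2>0. \<forall>u v.
             positive_smooth_solution n \<Omega> d\<^sub>1 d\<^sub>2 \<sigma> p q r s u v \<longrightarrow>
             (\<forall>x \<in> Euclidean_space n closure_of \<Omega>.
                u x \<le> c * (1 + (d\<^sub>2 / d\<^sub>1) powr \<gamma>) \<and>
                v x \<le> c * (1 + (d\<^sub>2 / d\<^sub>1) powr (r / (s + 1) * \<gamma>))))))"
proof (intro conjI impI allI)
  have r: "r > 0" using assms by (cases "r = 0") auto
  have p: "p > 1" using assms(5) r by (simp add: zero_less_divide_iff)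
  have pq: "(p - 1) * (s + 1) < q * r" using assms(6) r assms(4) by (simp add: field_simps)
  have q: "q > 0"
  proof (rule ccontr)
    assume "\<not> q > 0"
    hence "(p - 1) * (s + 1) < 0" using pq assms(2) by simp
    thus False using p assms(4) by (simp add: mult_less_0_iff)
  qed
  show "\<exists>c>0. \<exists>\<gamma>>0. \<forall>d\<^sub>1>0. \<forall>d\<^sub>2>0. \<forall>u v.
             positive_smooth_solution n \<Omega> d\<^sub>1 d\<^sub>2 0 p q r s u v \<longrightarrow>
             (\<forall>x \<in> Euclidean_space n closure_of \<Omega>.
                u x \<le> c * (1 + (d\<^sub>2 / d\<^sub>1) powr \<gamma>) \<and>
                v x \<le> c * (1 + (d\<^sub>2 / d\<^sub>1) powr (r / (s + 1) * \<gamma>)))"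
    if qs: "q < s + 1" and dom: "n \<ge> 1 \<and> bounded_smooth_domain n \<Omega>" for n \<Omega>
  proof -
    have "(p - 1) * (s + 1) / q < r" using pq q by (simp add: field_simps)
    from uniform_upper_bounds[OF r assms(4) order_refl q qs this zero_less_one, of q]
    obtain c \<gamma> where "c > 0" "\<gamma> > 0"
      and *: "\<And>n \<Omega> d\<^sub>1 d\<^sub>2 u v. neumann_solution n \<Omega> d\<^sub>1 d\<^sub>2 0 p q r s u v \<Longrightarrow>
        \<forall>x \<in> Euclidean_space n closure_of \<Omega>.
          u x \<le> c * (1 + (d\<^sub>2 / d\<^sub>1) powr \<gamma>) \<and> v x \<le> c * (1 + (d\<^sub>2 / d\<^sub>1) powr (r / (s + 1) * \<gamma>))"
      by auto
    moreover have "neumann_solution n \<Omega> d\<^sub>1 d\<^sub>2 0 p q r s u v"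
      if "d\<^sub>1 > 0" "d\<^sub>2 > 0" "positive_smooth_solution n \<Omega> d\<^sub>1 d\<^sub>2 0 p q r s u v" for d\<^sub>1 d\<^sub>2 u v
      using that dom r assms(4) by unfold_locales auto
    ultimately show ?thesis by blast
  qed
  show "\<exists>c :: real \<Rightarrow> real.
        (\<forall>\<tau>>0. max 1 \<tau> * r < s + 1 \<longrightarrow> c \<tau> > 0) \<and>
        (\<forall>n \<Omega> d\<^sub>1 d\<^sub>2 u v.
           n \<ge> 1 \<and> bounded_smooth_domain n \<Omega> \<and> d\<^sub>1 > 0 \<and> d\<^sub>2 > 0 \<and>
           max 1 (d\<^sub>2 / d\<^sub>1) * r < s + 1 \<and>
           positive_smooth_solution n \<Omega> d\<^sub>1 d\<^sub>2 0 p q r s u v \<longrightarrow>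
           (\<forall>x \<in> Euclidean_space n closure_of \<Omega>.
              u x \<ge> c (d\<^sub>2 / d\<^sub>1) \<and> v x \<ge> c (d\<^sub>2 / d\<^sub>1) powr (r / (s + 1)))) \<and>
        (c \<longlongrightarrow> 0) (at ((s + 1) / r) within {\<tau>. 0 < \<tau> \<and> max 1 \<tau> * r < s + 1})"
  proof -
    define a where "a = q / (s + 1) / (r / (s + 1) * q - (p - 1))"
    define c where "c = (\<lambda>\<tau>. (1 - r / (s + 1) * \<tau>) powr a)"
    have e: "p - 1 < r / (s + 1) * q" using pq assms(4) by (simp add: field_simps)
    have a: "a > 0" using e q assms(4) by (simp add: a_def)
    have range: "r < s + 1" "r / (s + 1) * \<tau> < 1" if "max 1 \<tau> * r < s + 1" for \<tau>
    proof -
      have "1 * r \<le> max 1 \<tau> * r" "\<tau> * r \<le> max 1 \<tau> * r" using r by (intro mult_right_mono; simp)+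
      thus "r < s + 1" "r / (s + 1) * \<tau> < 1" using that assms(4) by (auto simp: field_simps)
    qed
    have "c \<tau> > 0" if "max 1 \<tau> * r < s + 1" for \<tau> using range(2)[OF that] unfolding c_def powr_gt_zero by linarith
    moreover have "u x \<ge> c (d\<^sub>2 / d\<^sub>1) \<and> v x \<ge> c (d\<^sub>2 / d\<^sub>1) powr (r / (s + 1))"
      if "n \<ge> 1 \<and> bounded_smooth_domain n \<Omega> \<and> d\<^sub>1 > 0 \<and> d\<^sub>2 > 0 \<and>
           max 1 (d\<^sub>2 / d\<^sub>1) * r < s + 1 \<and> positive_smooth_solution n \<Omega> d\<^sub>1 d\<^sub>2 0 p q r s u v"
        and x: "x \<in> Euclidean_space n closure_of \<Omega>" for n \<Omega> d\<^sub>1 d\<^sub>2 u v x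
    proof -
      interpret neumann_solution n \<Omega> d\<^sub>1 d\<^sub>2 0 p q r s u v
        using that r assms(4) by unfold_locales auto
      have max: "max 1 (d\<^sub>2 / d\<^sub>1) * r < s + 1" using that by blast
      have "c (d\<^sub>2 / d\<^sub>1) \<le> u y" if "y \<in> cl" for y
        using activator_ge[OF refl assms(2) range[OF max] e that] unfolding c_def a_def .
      thus ?thesis using inhibitor_ge[of "c (d\<^sub>2 / d\<^sub>1)" x] x by (auto simp: c_def)
    qed
    moreover have "(c \<longlongrightarrow> 0) (at ((s + 1) / r) within {\<tau>. 0 < \<tau> \<and> max 1 \<tau> * r < s + 1})"
    proof -
      let ?F = "at ((s + 1) / r) within {\<tau>. 0 < \<tau> \<and> max 1 \<tau> * r < s + 1}"
      have "((\<lambda>\<tau>. 1 - r / (s + 1) * \<tau>) \<longlongrightarrow> 1 - r / (s + 1) * ((s + 1) / r)) ?F"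
        by (intro tendsto_intros)
      hence lim: "((\<lambda>\<tau>. 1 - r / (s + 1) * \<tau>) \<longlongrightarrow> 0) ?F" using r assms(4) by simp
      have "\<forall>\<^sub>F \<tau> in ?F. 0 \<le> 1 - r / (s + 1) * \<tau>"
        unfolding eventually_at_filter
      proof (intro always_eventually allI impI)
        fix \<tau> assume "\<tau> \<in> {\<tau>. 0 < \<tau> \<and> max 1 \<tau> * r < s + 1}"
        hence "r / (s + 1) * \<tau> < 1" using range(2) by blast
        thus "0 \<le> 1 - r / (s + 1) * \<tau>" by linarith
      qed
      from tendsto_powr'[OF lim tendsto_const[of a]] this a show ?thesis by (simp add: c_def)
    qed
    ultimately show ?thesis by (intro exI[of _ c] conjI) auto
  qed
  show "\<exists>c>0. \<exists>\<gamma>>0. \<forall>d\<^sub>1>0. \<forall>d\<^sub>2>0. \<forall>u v.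
             positive_smooth_solution n \<Omega> d\<^sub>1 d\<^sub>2 \<sigma> p q r s u v \<longrightarrow>
             (\<forall>x \<in> Euclidean_space n closure_of \<Omega>.
                u x \<le> c * (1 + (d\<^sub>2 / d\<^sub>1) powr \<gamma>) \<and>
                v x \<le> c * (1 + (d\<^sub>2 / d\<^sub>1) powr (r / (s + 1) * \<gamma>)))"
    if \<sigma>: "\<sigma> > 0" and pr: "p - 1 < r" and dom: "n \<ge> 1 \<and> bounded_smooth_domain n \<Omega>" for \<sigma> n \<Omega>
  proof -
    have "(p - 1) * (s + 1) / r < q" using pq r by (simp add: field_simps)
    moreover have "(p - 1) * (s + 1) / r < s + 1"
      using mult_strict_right_mono[OF pr, of "s + 1"] assms(4) r by (simp add: field_simps)
    ultimately have "(p - 1) * (s + 1) / r < min q (s + 1)" by simp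
    \<comment> \<open>Lowering \<open>q\<close> to \<open>Q\<close> costs a factor, a power of the lower bound \<open>\<rho>\<close> of \<open>v\<close>.\<close>
    then obtain Q where Q: "(p - 1) * (s + 1) / r < Q" "Q < min q (s + 1)" using dense by blast
    have "0 \<le> (p - 1) * (s + 1) / r" using p r assms(4) by simp
    hence Q0: "Q > 0" using Q(1) by linarith
    have Qr: "(p - 1) * (s + 1) / Q < r" using Q(1) Q0 r by (simp add: field_simps)
    define \<rho> where "\<rho> = \<sigma> powr (r / (s + 1))"
    have \<rho>: "\<rho> > 0" using \<sigma> by (simp add: \<rho>_def)
    have "\<rho> powr (Q - q) > 0" using \<rho> by simp
    from uniform_upper_bounds[OF r assms(4) less_imp_le[OF \<sigma>] Q0 _ Qr this, of q] Q(2)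
    obtain c \<gamma> where "c > 0" "\<gamma> > 0"
      and *: "\<And>n \<Omega> d\<^sub>1 d\<^sub>2 u v. neumann_solution n \<Omega> d\<^sub>1 d\<^sub>2 \<sigma> p q r s u v \<Longrightarrow>
        \<forall>x \<in> Euclidean_space n closure_of \<Omega>.
          u x powr (p - 1) / v x powr q \<le> \<rho> powr (Q - q) * (u x powr (p - 1) / v x powr Q) \<Longrightarrow>
        \<forall>x \<in> Euclidean_space n closure_of \<Omega>.
          u x \<le> c * (1 + (d\<^sub>2 / d\<^sub>1) powr \<gamma>) \<and> v x \<le> c * (1 + (d\<^sub>2 / d\<^sub>1) powr (r / (s + 1) * \<gamma>))"
      by auto
    moreover have sol: "neumann_solution n \<Omega> d\<^sub>1 d\<^sub>2 \<sigma> p q r s u v"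
      if "d\<^sub>1 > 0" "d\<^sub>2 > 0" "positive_smooth_solution n \<Omega> d\<^sub>1 d\<^sub>2 \<sigma> p q r s u v" for d\<^sub>1 d\<^sub>2 u v
      using that dom r assms(4) by unfold_locales auto
    moreover have "u x powr (p - 1) / v x powr q \<le> \<rho> powr (Q - q) * (u x powr (p - 1) / v x powr Q)"
      if "neumann_solution n \<Omega> d\<^sub>1 d\<^sub>2 \<sigma> p q r s u v" and x: "x \<in> Euclidean_space n closure_of \<Omega>"
      for d\<^sub>1 d\<^sub>2 u v x
    proof -
      interpret neumann_solution n \<Omega> d\<^sub>1 d\<^sub>2 \<sigma> p q r s u v by fact
      have "\<rho> \<le> v x"
        using inhibitor_ge[OF activator_ge_source less_imp_le[OF \<sigma>] x] by (simp add: \<rho>_def)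
      hence "v x powr (Q - q) \<le> \<rho> powr (Q - q)" using Q(2) \<rho> by (intro powr_mono2') auto
      hence "u x powr (p - 1) / v x powr Q * v x powr (Q - q) \<le> u x powr (p - 1) / v x powr Q * \<rho> powr (Q - q)"
        by (intro mult_left_mono) auto
      thus ?thesis using pos(2)[OF x] by (simp add: powr_diff mult_ac)
    qed
    ultimately show ?thesis by blast
  qed
qed

end
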